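(* Let $\alpha>-\frac12$, let $1\le p\le\infty$, and put $a=\alpha+\frac12+\frac{1}{2\max\{2,p\}}$ (with $\frac{1}{2\max\{2,p\}}=0$ when $p=\infty$). Then, for any function $\varphi:(0,+\infty)\to(0,+\infty)$ with $\varphi(r)\to\infty$ as $r\to\infty$, there is an entire function $f$ with $$M_p(f,r)\le\varphi(r)\,\frac{e^r}{r^{a}}\quad\text{for all sufficiently large } r>0$$ that is frequently hypercyclic for the Dunkl operator $\Lambda_\alpha$.
   Context: $H(\mathbb{C})$ is the vector space of all entire functions $\mathbb{C}\to\mathbb{C}$ with the topology of local uniform convergence (uniform convergence on compact sets). For $\alpha>-\frac12$, the Dunkl operator $\Lambda_\alpha:H(\mathbb{C})\to H(\mathbb{C})$ is the continuous linear operator given by $$\Lambda_\alpha f(z)=f'(z)+\frac{2\alpha+1}{z}\cdot\frac{f(z)-f(-z)}{2},$$ where the value at $z=0$ is understood by removing the singularity. The lower density of a set $A\subset\mathbb{N}=\{1,2,3,\dots\}$ is $\underline{\mathrm{dens}}(A)=\liminf_{N\to\infty}\frac{\#\{n\in A:\,n\le N\}}{N}$. A function $f\in H(\mathbb{C})$ is frequently hypercyclic for $\Lambda_\alpha$ if for every non-empty open set $U\subset H(\mathbb{C})$ one has $\underline{\mathrm{dens}}\{n\in\mathbb{N}:\Lambda_\alpha^n f\in U\}>0$. For an entire function $f$ and $r>0$, $M_p(f,r)=\Big(\frac{1}{2\pi}\int_0^{2\pi}|f(re^{it})|^p\,dt\Big)^{1/p}$ if $1\le p<\infty$, and $M_\infty(f,r)=\sup_{|z|=r}|f(z)|$.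 *)

theory Defs
  imports "HOL-Complex_Analysis.Complex_Analysis"
begin

definition entire :: "(complex \<Rightarrow> complex) set" where
  "entire = {f. f holomorphic_on UNIV}"

text \<open>
  The topology of uniform convergence on compact sets. For entire \<open>f\<close>, the sets
  \<open>{g \<in> entire. \<forall>z\<in>K. norm (g z - f z) < \<epsilon>}\<close> with \<open>K\<close> compact and \<open>\<epsilon> > 0\<close>
  form a neighbourhood base at \<open>f\<close>.
\<close>

definition entire_topology :: "(complex \<Rightarrow> complex) topology" where
  "entire_topology = topology (\<lambda>U. U \<subseteq> entire \<and>
     (\<forall>f\<in>U. \<exists>K \<epsilon>. compact K \<and> \<epsilon> > 0 \<and>
        {g \<in> entire. \<forall>z\<in>K. norm (g z - f z) < \<epsilon>} \<subseteq> U))"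

lemma openin_entire_topology:
  "openin entire_topology U \<longleftrightarrow> U \<subseteq> entire \<and>
     (\<forall>f\<in>U. \<exists>K \<epsilon>. compact K \<and> \<epsilon> > 0 \<and>
        {g \<in> entire. \<forall>z\<in>K. norm (g z - f z) < \<epsilon>} \<subseteq> U)"
proof -
  let ?P = "\<lambda>U. U \<subseteq> entire \<and>
     (\<forall>f\<in>U. \<exists>K \<epsilon>. compact K \<and> \<epsilon> > 0 \<and>
        {g \<in> entire. \<forall>z\<in>K. norm (g z - f z) < \<epsilon>} \<subseteq> U)"
  have Int: "?P (S \<inter> T)" if S: "?P S" and T: "?P T" for S T
  proof (intro conjI ballI)
    show "S \<inter> T \<subseteq> entire" using S by blast
    fix f assume f: "f \<in> S \<inter> T"
    obtain K e where 1: "compact K" "(e::real) > 0"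
      "{g \<in> entire. \<forall>z\<in>K. norm (g z - f z) < e} \<subseteq> S" using S f by blast
    obtain L d where 2: "compact L" "(d::real) > 0"
      "{g \<in> entire. \<forall>z\<in>L. norm (g z - f z) < d} \<subseteq> T" using T f by blast
    have "{g \<in> entire. \<forall>z\<in>K \<union> L. norm (g z - f z) < min e d} \<subseteq> S \<inter> T"
      using 1(3) 2(3) by auto
    moreover have "compact (K \<union> L)" "min e d > 0" using 1 2 by auto
    ultimately show "\<exists>K \<epsilon>. compact K \<and> \<epsilon> > 0 \<and>
        {g \<in> entire. \<forall>z\<in>K. norm (g z - f z) < \<epsilon>} \<subseteq> S \<inter> T" by blast
  qed
  have Un: "?P (\<Union>\<K>)" if "\<forall>U\<in>\<K>. ?P U" for \<K>
  proof (intro conjI ballI)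
    show "\<Union>\<K> \<subseteq> entire" by (rule Union_least) (use that in simp)
    fix f assume "f \<in> \<Union>\<K>"
    then obtain U where U: "U \<in> \<K>" "f \<in> U" by blast
    have "?P U" using that U(1) by (rule bspec)
    then obtain K e where "compact K" "(e::real) > 0"
      "{g \<in> entire. \<forall>z\<in>K. norm (g z - f z) < e} \<subseteq> U"
      using U(2) by (elim conjE) (drule (1) bspec, blast)
    moreover have "U \<subseteq> \<Union>\<K>" using U by blast
    ultimately show "\<exists>K \<epsilon>. compact K \<and> \<epsilon> > 0 \<and>
        {g \<in> entire. \<forall>z\<in>K. norm (g z - f z) < \<epsilon>} \<subseteq> \<Union>\<K>" by (meson subset_trans)
  qed
  have "istopology ?P"
    unfolding istopology_def
  proof (rule conjI)
    show "\<forall>S T. ?P S \<longrightarrow> ?P T \<longrightarrow> ?P (S \<inter> T)"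
      by (intro allI impI) (rule Int)
    show "\<forall>\<K>. (\<forall>U\<in>\<K>. ?P U) \<longrightarrow> ?P (\<Union>\<K>)"
      by (intro allI impI) (rule Un)
  qed
  then show ?thesis
    unfolding entire_topology_def by simp
qed

lemma topspace_entire_topology [simp]: "topspace entire_topology = entire"
proof -
  have "openin entire_topology entire"
    unfolding openin_entire_topology
    by (auto intro!: exI[of _ "{}"] exI[of _ "1::real"])
  then have "entire \<subseteq> topspace entire_topology"
    by (rule openin_subset)
  moreover have "topspace entire_topology \<subseteq> entire"
    using openin_topspace[of entire_topology] by (simp only: openin_entire_topology)
  ultimately show ?thesis
    by (rule subset_antisym[rotated])
qed

definition dunkl :: "real \<Rightarrow> (complex \<Rightarrow> complex) \<Rightarrow> complex \<Rightarrow> complex" where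
  "dunkl \<alpha> f = remove_sings
     (\<lambda>z. deriv f z + of_real (2 * \<alpha> + 1) / z * ((f z - f (- z)) / 2))"

definition lower_density :: "nat set \<Rightarrow> ereal" where
  "lower_density A = liminf (\<lambda>N. ereal (real (card {n \<in> A. 1 \<le> n \<and> n \<le> N}) / real N))"

definition frequently_hypercyclic :: "'a topology \<Rightarrow> ('a \<Rightarrow> 'a) \<Rightarrow> 'a \<Rightarrow> bool" where
  "frequently_hypercyclic X T x \<longleftrightarrow> x \<in> topspace X \<and>
     (\<forall>U. openin X U \<and> U \<noteq> {} \<longrightarrow> lower_density {n. (T ^^ n) x \<in> U} > 0)"

text \<open>The intended range of \<open>p\<close> is \<open>1 \<le> p \<le> \<infinity>\<close>.\<close>

definition integral_mean :: "ereal \<Rightarrow> (complex \<Rightarrow> complex) \<Rightarrow> real \<Rightarrow> real" where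
  "integral_mean p f r =
     (if p = \<infinity> then (SUP z\<in>sphere 0 r. norm (f z))
      else (1 / (2 * pi) *
             integral {0..2 * pi} (\<lambda>t. norm (f (of_real r * exp (\<i> * of_real t))) powr real_of_ereal p))
           powr (1 / real_of_ereal p))"

end

theory Submission
  imports Defs
begin

text \<open>
  With \<open>\<gamma>\<^sub>n = dunkl_fact \<alpha> n\<close>, the Dunkl operator maps \<open>\<Sum> b\<^sub>n z\<^sup>n / \<gamma>\<^sub>n\<close> to
  \<open>\<Sum> b\<^sub>n\<^sub>+\<^sub>1 z\<^sup>n / \<gamma>\<^sub>n\<close>, so it suffices to find a sequence \<open>b\<close> of slow growth whose shifts
  approximate every finite word with positive lower density. Such a \<open>b\<close> is obtained by placing
  words of level \<open>l\<close> at the indices with 2-adic valuation \<open>l\<close>, with gaps of length about \<open>l\<close>.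

  For the growth, \<open>\<gamma>\<^sub>n\<close> is at least of order \<open>n! n\<^sup>s\<close> with \<open>s = \<alpha> + 1/2\<close>. Negative moments of the
  Poisson distribution bound the sup norm by \<open>e\<^sup>r r\<^sup>-\<^sup>s\<close>, and together with the bound
  \<open>r\<^sup>n / n! \<le> e\<^sup>r / sqrt (n + 1)\<close> and Parseval's identity they gain a factor \<open>r\<^sup>-\<^sup>1\<^sup>/\<^sup>4\<close> in the
  quadratic mean. All other \<open>p\<close> follow by interpolation between the cases 2 and \<open>\<infinity>\<close>.
\<close>

subsection \<open>Poisson weights\<close>

text \<open>Follows from \<open>1 / (1 + x) = 1 - x / (1 + x) \<le> exp (- (x / (1 + x)))\<close>.
  The loss against \<open>1 + x \<le> exp x\<close> is only quadratic, hence summable when the Dunkl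
  weights are multiplied up.\<close>

lemma one_plus_ge_exp:
  fixes x :: real
  assumes "0 \<le> x"
  shows "exp (x - x\<^sup>2) \<le> 1 + x"
proof -
  have "1 - x / (1 + x) \<le> exp (- (x / (1 + x)))"
    using exp_ge_add_one_self[of "- (x / (1 + x))"] by simp
  moreover have "1 - x / (1 + x) = 1 / (1 + x)"
    using assms by (simp add: field_simps)
  ultimately have "exp (x / (1 + x)) \<le> 1 + x"
    using assms by (simp add: exp_minus field_simps)
  moreover have "x - x\<^sup>2 \<le> x / (1 + x)"
    using assms by (simp add: field_simps power2_eq_square)
  ultimately show ?thesis
    by (meson exp_le_cancel_iff order_trans)
qed

text \<open>The bound is the Pade approximant of type [2/1] and agrees with
  \<open>ln (1 + x)\<close> to third order, so the derivative of the difference has numerator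
  \<open>4 * t ^ 3\<close>. This accuracy leaves room for the square root in the next lemma.\<close>

lemma ln_one_plus_le_rational:
  fixes x :: real
  assumes "0 \<le> x"
  shows "ln (1 + x) \<le> x * (6 + x) / (6 + 4 * x)"
proof -
  let ?g = "\<lambda>x::real. x * (6 + x) / (6 + 4 * x) - ln (1 + x)"
  have "?g 0 \<le> ?g x"
  proof (rule DERIV_nonneg_imp_nondecreasing[OF assms])
    fix t :: real assume t: "0 \<le> t" "t \<le> x"
    have "(?g has_real_derivative
        ((6 + 2 * t) * (6 + 4 * t) - t * (6 + t) * 4) / (6 + 4 * t)\<^sup>2 - 1 / (1 + t)) (at t)"
      using t by (auto intro!: derivative_eq_intros simp: power2_eq_square algebra_simps)
    moreover have "((6 + 2 * t) * (6 + 4 * t) - t * (6 + t) * 4) / (6 + 4 * t)\<^sup>2 - 1 / (1 + t)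
        = 4 * t ^ 3 / ((6 + 4 * t)\<^sup>2 * (1 + t))"
      using t by (simp add: divide_simps) (simp add: power2_eq_square power3_eq_cube algebra_simps)
    moreover have "0 \<le> 4 * t ^ 3 / ((6 + 4 * t)\<^sup>2 * (1 + t))"
      using t by simp
    ultimately show "\<exists>y. (?g has_real_derivative y) (at t) \<and> 0 \<le> y"
      by auto
  qed
  then show ?thesis by simp
qed

text \<open>A weak Stirling bound. Comparing the ratios of consecutive terms, the induction reduces
  to \<open>(1 + 1 / n) ^ n * sqrt (1 + 1 / (n + 1)) \<le> exp 1\<close>, checked after taking
  logarithms.\<close>

lemma sqrt_power_self_le:
  "sqrt (real n + 1) * real n ^ n \<le> fact n * exp (real n)"
proof (induction n)
  case 0
  show ?case by simp
next
  case (Suc n)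
  show ?case
  proof (cases "n = 0")
    case True
    have "sqrt 2 \<le> (2::real)" by (rule real_le_lsqrt) auto
    also have "(2::real) \<le> exp 1" using exp_ge_add_one_self[of 1] by simp
    finally show ?thesis using True by simp
  next
    case False
    define t where "t = real n"
    have t: "t > 0" using False by (simp add: t_def)
    have "t * ln (1 + 1 / t) \<le> t * (1 / t * (6 + 1 / t) / (6 + 4 * (1 / t)))"
      using t by (intro mult_left_mono ln_one_plus_le_rational) auto
    also have "\<dots> = 1 - 3 / (6 * t + 4)"
      using t by (simp add: divide_simps)
    finally have 1: "t * ln (1 + 1 / t) \<le> 1 - 3 / (6 * t + 4)" .
    have "ln (1 + 1 / (t + 1)) / 2 \<le> 1 / (t + 1) / 2"
      using t by (intro divide_right_mono ln_add_one_self_le_self) auto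
    also have "\<dots> \<le> 3 / (6 * t + 4)"
      using t by (simp add: field_simps)
    finally have 2: "t * ln (1 + 1 / t) + ln (1 + 1 / (t + 1)) / 2 \<le> 1"
      using 1 by linarith
    have "(1 + 1 / t) ^ n * sqrt (1 + 1 / (t + 1)) = exp (t * ln (1 + 1 / t) + ln (1 + 1 / (t + 1)) / 2)"
    proof -
      have "exp (t * ln (1 + 1 / t)) = (1 + 1 / t) ^ n"
        using t unfolding t_def exp_of_nat_mult by (simp add: add_pos_pos)
      moreover have "exp (ln (1 + 1 / (t + 1)) / 2) = sqrt (1 + 1 / (t + 1))"
        using t by (simp add: add_pos_pos flip: ln_sqrt)
      ultimately show ?thesis by (simp add: exp_add)
    qed
    also have "\<dots> \<le> exp 1" using 2 by simp
    finally have 3: "(1 + 1 / t) ^ n * sqrt (1 + 1 / (t + 1)) \<le> exp 1" .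
    have a: "t + 1 = t * (1 + 1 / t)" and b: "t + 2 = (t + 1) * (1 + 1 / (t + 1))"
      using t by (auto simp: field_simps)
    have "sqrt (t + 2) * (t + 1) ^ Suc n
        = (t + 1) * (sqrt (t + 1) * t ^ n) * ((1 + 1 / t) ^ n * sqrt (1 + 1 / (t + 1)))"
    proof -
      have "(t + 1) ^ n = t ^ n * (1 + 1 / t) ^ n"
        by (subst a) (rule power_mult_distrib)
      moreover have "sqrt (t + 2) = sqrt (t + 1) * sqrt (1 + 1 / (t + 1))"
        by (subst b) (rule real_sqrt_mult)
      ultimately show ?thesis by (simp add: algebra_simps)
    qed
    also have "\<dots> \<le> (t + 1) * (fact n * exp t) * exp 1"
      using t Suc 3 by (intro mult_mono[OF mult_left_mono 3]) (auto simp: t_def)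
    also have "\<dots> = fact (Suc n) * exp (real (Suc n))"
      by (simp add: t_def exp_add algebra_simps)
    finally show ?thesis by (simp add: t_def algebra_simps)
  qed
qed

text \<open>Raising \<open>r / n \<le> exp (r / n - 1)\<close> to the power \<open>n\<close> shows
  that the worst radius is \<open>r = n\<close>, where \<open>sqrt_power_self_le\<close>
  applies.\<close>

lemma power_div_fact_le:
  fixes r :: real
  assumes "0 \<le> r"
  shows "r ^ n / fact n \<le> exp r / sqrt (real n + 1)"
proof (cases "n = 0")
  case True
  then show ?thesis using assms by simp
next
  case False
  define t where "t = real n"
  have t: "t > 0" using False by (simp add: t_def)
  have "r / t \<le> exp (r / t - 1)"
    using exp_ge_add_one_self[of "r / t - 1"] by simp
  then have "(r / t) ^ n \<le> exp (r / t - 1) ^ n"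
    using assms t by (intro power_mono) auto
  also have "\<dots> = exp (r - t)"
    using t by (simp add: exp_of_nat_mult[symmetric] t_def right_diff_distrib)
  finally have "r ^ n \<le> exp (r - t) * t ^ n"
    using t by (simp add: power_divide field_simps)
  then have "sqrt (t + 1) * r ^ n \<le> exp (r - t) * (sqrt (t + 1) * t ^ n)"
    using t by (simp add: mult_left_mono algebra_simps)
  also have "\<dots> \<le> exp (r - t) * (fact n * exp t)"
    using sqrt_power_self_le[of n] by (intro mult_left_mono) (auto simp: t_def)
  also have "\<dots> = exp r * fact n" by (simp add: exp_diff)
  finally show ?thesis using t by (simp add: t_def field_simps)
qed

lemma exp_sums: "(\<lambda>n. r ^ n / fact n) sums exp (r::real)"
  using exp_converges[of r] by (simp add: divide_inverse mult.commute)

text \<open>The pointwise bound \<open>x\<^sup>s \<le> 1 + x\<^sup>m\<close> with an integer \<open>m \<ge> s\<close> reduces the claim to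
  integral moments, where the series becomes a tail of the exponential series.\<close>

lemma poisson_negative_moment:
  fixes s :: real
  assumes "0 \<le> s"
  obtains C where "C > 0"
    "\<And>r. r > 0 \<Longrightarrow> summable (\<lambda>n. r ^ n / fact n * (real n + 1) powr - s)"
    "\<And>r. r > 0 \<Longrightarrow> (\<Sum>n. r ^ n / fact n * (real n + 1) powr - s) \<le> C * exp r * r powr - s"
proof -
  define m where "m = nat \<lceil>s\<rceil>"
  have m: "s \<le> real m" unfolding m_def by linarith
  \<comment> \<open>Each new factor obeys \<open>n + 1 + m \<le> (m + 1) * (n + 1)\<close>. This
    turns division by \<open>(n + 1) ^ m\<close> into a shift of the factorial.\<close>
  have fm: "(fact (n + m) :: real) \<le> fact n * (fact m * (real n + 1) ^ m)" for n
  proof (induction m)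
    case (Suc m)
    have "(fact (n + Suc m) :: real) = (real n + 1 + real m) * fact (n + m)"
      by (simp add: algebra_simps)
    also have "\<dots> \<le> (real (Suc m) * (real n + 1)) * (fact n * (fact m * (real n + 1) ^ m))"
      by (intro mult_mono Suc) (auto simp: algebra_simps)
    also have "\<dots> = fact n * (fact (Suc m) * (real n + 1) ^ Suc m)"
      by (simp add: algebra_simps)
    finally show ?case .
  qed simp
  define C :: real where "C = 1 + fact m"
  show ?thesis
  proof (rule that)
    show "C > 0" unfolding C_def by (simp add: add_pos_pos)
    fix r :: real assume r: "r > 0"
    define g where "g n = r powr - s * (r ^ n / fact n + fact m * (r ^ (n + m) / fact (n + m)))" for n
    have sum_e: "summable (\<lambda>n. r ^ n / fact n)" using exp_sums sums_summable by blast
    then have sum_e': "summable (\<lambda>n. r ^ (n + m) / fact (n + m))"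
      by (subst summable_iff_shift)
    have sg: "summable g" unfolding g_def
      by (intro summable_mult summable_add sum_e sum_e')
    have le: "r ^ n / fact n * (real n + 1) powr - s \<le> g n" for n
    proof -
      \<comment> \<open>Chosen so that \<open>(n + 1) powr - s = r powr - s * x powr s\<close>: the
        expected decay in \<open>r\<close> factors out of every term.\<close>
      define x where "x = r / (real n + 1)"
      have x: "x > 0" using r by (simp add: x_def)
      have "x powr s \<le> 1 + x ^ m"
      proof (cases "x \<le> 1")
        case True
        then have "x powr s \<le> 1" using x assms by (simp add: powr_le1)
        then show ?thesis using x by (simp add: add_increasing2)
      next
        case False
        then have "x powr s \<le> x powr real m" using m by (intro powr_mono) auto
        then show ?thesis using x by (simp add: powr_realpow)
      qed
      then have "r ^ n / fact n * x powr s \<le> r ^ n / fact n * (1 + x ^ m)"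
        using r by (intro mult_left_mono) auto
      also have "\<dots> = r ^ n / fact n + r ^ (n + m) / (fact n * (real n + 1) ^ m)"
        by (simp add: x_def power_divide power_add field_simps)
      also have "r ^ (n + m) / (fact n * (real n + 1) ^ m) \<le> fact m * (r ^ (n + m) / fact (n + m))"
        using fm[of n] r by (simp add: field_simps mult_left_mono)
      finally have *: "r ^ n / fact n * x powr s
          \<le> r ^ n / fact n + fact m * (r ^ (n + m) / fact (n + m))" by simp
      have "r ^ n / fact n * (real n + 1) powr - s = r powr - s * (r ^ n / fact n * x powr s)"
        using r by (simp add: x_def powr_divide powr_minus field_simps)
      also have "\<dots> \<le> g n" unfolding g_def using * r by (intro mult_left_mono) auto
      finally show ?thesis .
    qed
    show S: "summable (\<lambda>n. r ^ n / fact n * (real n + 1) powr - s)"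
      by (rule summable_comparison_test'[OF sg, of 0]) (use le r in auto)
    have "(\<Sum>n. r ^ n / fact n * (real n + 1) powr - s) \<le> suminf g"
      by (rule suminf_le[OF le S sg])
    also have "suminf g = r powr - s * (exp r + fact m * (\<Sum>n. r ^ (n + m) / fact (n + m)))"
    proof -
      have "g sums (r powr - s * (exp r + fact m * (\<Sum>n. r ^ (n + m) / fact (n + m))))"
        unfolding g_def using sum_e'
        by (intro sums_mult sums_add exp_sums summable_sums)
      then show ?thesis by (rule sums_unique[symmetric])
    qed
    also have "(\<Sum>n. r ^ (n + m) / fact (n + m)) \<le> exp r"
      using suminf_split_initial_segment[OF sum_e, of m] exp_sums[of r] r
        sum_nonneg[of "{..<m}" "\<lambda>n. r ^ n / fact n"]
      by (simp add: sums_unique[symmetric])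
    finally show "(\<Sum>n. r ^ n / fact n * (real n + 1) powr - s) \<le> C * exp r * r powr - s"
      unfolding C_def using r by (simp add: algebra_simps mult_left_mono)
  qed
qed

subsection \<open>Growth of the Dunkl factorials\<close>

text \<open>The operator maps \<open>z ^ n\<close> to
  \<open>dunkl_weight \<alpha> n * z ^ (n - 1)\<close>; the reflection term vanishes on even
  powers.\<close>

definition dunkl_weight :: "real \<Rightarrow> nat \<Rightarrow> real" where
  "dunkl_weight \<alpha> n = real n + (if odd n then 2 * \<alpha> + 1 else 0)"

definition dunkl_fact :: "real \<Rightarrow> nat \<Rightarrow> real" where
  "dunkl_fact \<alpha> n = (\<Prod>k=1..n. dunkl_weight \<alpha> k)"

lemma dunkl_fact_0 [simp]: "dunkl_fact \<alpha> 0 = 1"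
  by (simp add: dunkl_fact_def)

lemma dunkl_fact_Suc: "dunkl_fact \<alpha> (Suc n) = dunkl_weight \<alpha> (Suc n) * dunkl_fact \<alpha> n"
  by (simp add: dunkl_fact_def mult.commute)

context
  fixes \<alpha> :: real
  assumes \<alpha>: "\<alpha> > - 1 / 2"
begin

lemma dunkl_weight_ge: "real n \<le> dunkl_weight \<alpha> n"
  using \<alpha> by (simp add: dunkl_weight_def)

lemma dunkl_weight_Suc_pos: "0 < dunkl_weight \<alpha> (Suc n)"
  using dunkl_weight_ge[of "Suc n"] by linarith

lemma dunkl_fact_pos: "0 < dunkl_fact \<alpha> n"
  by (induction n) (auto simp: dunkl_fact_Suc dunkl_weight_Suc_pos)

text \<open>With \<open>s = \<alpha> + 1 / 2\<close>, the quotient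
  \<open>dunkl_fact \<alpha> n / fact n\<close> is the product of \<open>1 + 2 * s / k\<close> over
  odd \<open>k \<le> n\<close>, which is of order \<open>n powr s\<close>. By
  \<open>one_plus_ge_exp\<close> the error is governed by the convergent series of
  \<open>1 / k\<^sup>2\<close>.\<close>

lemma dunkl_fact_lower_bound:
  obtains c where "c > 0"
    "\<And>n. c * fact n * (real n + 1) powr (\<alpha> + 1 / 2) \<le> dunkl_fact \<alpha> n"
proof -
  define s where "s = \<alpha> + 1 / 2"
  have s: "s > 0" using \<alpha> by (simp add: s_def)
  define Q where "Q n = (\<Sum>k=1..n. 1 / (real k)\<^sup>2)" for n
  \<comment> \<open>The exponential absorbs the quadratic losses \<open>(2 * s / k)\<^sup>2\<close>.
    For odd \<open>n\<close> the base \<open>n + 2\<close> coincides with the base for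
    \<open>n + 1\<close>, since only odd indices enlarge the quotient.\<close>
  define X where "X n = exp (- (4 * s\<^sup>2 * Q n)) * (real n + (if odd n then 2 else 1)) powr s" for n
  have X: "fact n * X n \<le> dunkl_fact \<alpha> n" for n
  proof (induction n)
    case 0
    show ?case by (simp add: X_def Q_def)
  next
    case (Suc n)
    define t where "t = real (Suc n)"
    have t: "t > 0" by (simp add: t_def)
    have Q: "Q (Suc n) = Q n + 1 / t\<^sup>2" by (simp add: Q_def t_def)
    have "t * X (Suc n) \<le> dunkl_weight \<alpha> (Suc n) * X n"
    proof (cases "odd n")
      case True
      have "exp (- (4 * s\<^sup>2 * Q (Suc n))) \<le> exp (- (4 * s\<^sup>2 * Q n))"
        by (simp add: Q mult_left_mono)
      then have "X (Suc n) \<le> X n"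
        using True by (simp add: X_def add.commute mult_right_mono)
      then show ?thesis
        using True by (simp add: dunkl_weight_def t_def mult_left_mono)
    next
      case False
      \<comment> \<open>Here \<open>Suc n\<close> is odd: its weight is \<open>t * (1 + x)\<close>,
        and the base in \<open>X\<close> jumps from \<open>t\<close> to
        \<open>t + 2\<close>.\<close>
      define x where "x = 2 * s / t"
      have x: "x > 0" using s t by (simp add: x_def)
      have "((t + 2) / t) powr s = exp (s * ln (1 + 2 / t))"
        using t by (auto simp: powr_def add_divide_distrib add_pos_pos less_imp_neq[THEN not_sym])
      also have "\<dots> \<le> exp (s * (2 / t))"
        unfolding exp_le_cancel_iff
        using s t by (intro mult_left_mono ln_add_one_self_le_self) auto
      finally have p: "((t + 2) / t) powr s \<le> exp x" by (simp add: x_def mult.commute)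
      have "4 * s\<^sup>2 * Q (Suc n) = 4 * s\<^sup>2 * Q n + x\<^sup>2"
        by (simp add: Q x_def power_divide power_mult_distrib algebra_simps)
      then have "X (Suc n) = exp (- (4 * s\<^sup>2 * Q n)) * exp (- x\<^sup>2) * (((t + 2) / t) powr s * t powr s)"
      proof -
        have "((t + 2) / t) powr s * t powr s = (t + 2) powr s"
          using t by (simp flip: powr_mult)
        moreover have "exp (- (4 * s\<^sup>2 * Q (Suc n))) = exp (- (4 * s\<^sup>2 * Q n)) * exp (- x\<^sup>2)"
          by (simp only: exp_add[symmetric] \<open>4 * s\<^sup>2 * Q (Suc n) = _\<close> minus_add_distrib)
        ultimately show ?thesis
          using False by (simp add: X_def t_def)
      qed
      also have "\<dots> \<le> exp (- (4 * s\<^sup>2 * Q n)) * exp (- x\<^sup>2) * (exp x * t powr s)"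
        using p by (intro mult_left_mono mult_right_mono) auto
      also have "\<dots> = exp (- (4 * s\<^sup>2 * Q n)) * t powr s * exp (x - x\<^sup>2)"
        by (simp add: exp_diff exp_minus divide_inverse)
      also have "\<dots> \<le> exp (- (4 * s\<^sup>2 * Q n)) * t powr s * (1 + x)"
        using x by (intro mult_left_mono one_plus_ge_exp) auto
      also have "exp (- (4 * s\<^sup>2 * Q n)) * t powr s = X n"
        using False by (simp add: X_def t_def add.commute)
      finally have "t * X (Suc n) \<le> t * (X n * (1 + x))" using t by simp
      also have "\<dots> = dunkl_weight \<alpha> (Suc n) * X n"
        using False t by (simp add: x_def dunkl_weight_def s_def t_def field_simps)
      finally show ?thesis .
    qed
    then have "fact n * (t * X (Suc n)) \<le> fact n * (dunkl_weight \<alpha> (Suc n) * X n)"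
      by (intro mult_left_mono) auto
    also have "\<dots> \<le> dunkl_weight \<alpha> (Suc n) * dunkl_fact \<alpha> n"
      using Suc dunkl_weight_Suc_pos[of n] by (simp add: mult.left_commute)
    finally show ?case by (simp add: dunkl_fact_Suc t_def algebra_simps)
  qed
  have sm: "summable (\<lambda>n. 1 / (real n)\<^sup>2)"
    using inverse_power_summable[of 2, where 'a=real] by (simp add: divide_inverse)
  define T where "T = (\<Sum>n. 1 / (real n)\<^sup>2)"
  have T: "Q n \<le> T" for n
    unfolding Q_def T_def by (rule sum_le_suminf[OF sm]) auto
  show ?thesis
  proof (rule that)
    show "exp (- (4 * s\<^sup>2 * T)) > 0" by simp
    fix n
    have "exp (- (4 * s\<^sup>2 * T)) * (real n + 1) powr s \<le> X n"
      unfolding X_def using T[of n] s by (intro mult_mono powr_mono2) (auto simp: mult_left_mono)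
    then have "fact n * (exp (- (4 * s\<^sup>2 * T)) * (real n + 1) powr s) \<le> fact n * X n"
      by (intro mult_left_mono) auto
    also note X[of n]
    finally show "exp (- (4 * s\<^sup>2 * T)) * fact n * (real n + 1) powr (\<alpha> + 1 / 2) \<le> dunkl_fact \<alpha> n"
      by (simp add: mult_ac flip: s_def)
  qed
qed

text \<open>The lower bound on \<open>dunkl_fact\<close> turns both sums into negative Poisson
  moments. The first serves the sup norm, the second the quadratic mean.\<close>

lemma dunkl_series_growth:
  obtains C where "C > 0"
    "\<And>r. r > 0 \<Longrightarrow> summable (\<lambda>n. r ^ n / dunkl_fact \<alpha> n)"
    "\<And>r. r > 0 \<Longrightarrow> (\<Sum>n. r ^ n / dunkl_fact \<alpha> n) \<le> C * (exp r * r powr - (\<alpha> + 1 / 2))"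
    "\<And>r. r > 0 \<Longrightarrow> summable (\<lambda>n. (r ^ n / dunkl_fact \<alpha> n)\<^sup>2)"
    "\<And>r. r > 0 \<Longrightarrow> (\<Sum>n. (r ^ n / dunkl_fact \<alpha> n)\<^sup>2)
        \<le> (C * (exp r * r powr - (\<alpha> + 3 / 4)))\<^sup>2"
proof -
  define s where "s = \<alpha> + 1 / 2"
  have s: "s > 0" using \<alpha> by (simp add: s_def)
  obtain c where c: "c > 0" "\<And>n. c * fact n * (real n + 1) powr s \<le> dunkl_fact \<alpha> n"
    using dunkl_fact_lower_bound unfolding s_def by blast
  obtain C1 where C1: "C1 > 0"
    "\<And>r. r > 0 \<Longrightarrow> summable (\<lambda>n. r ^ n / fact n * (real n + 1) powr - s)"
    "\<And>r. r > 0 \<Longrightarrow> (\<Sum>n. r ^ n / fact n * (real n + 1) powr - s) \<le> C1 * exp r * r powr - s"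
    by (rule poisson_negative_moment[OF less_imp_le[OF s]]) blast
  \<comment> \<open>The part \<open>2 * s\<close> comes from squaring, the part \<open>1 / 2\<close>
    from replacing one of the two factors \<open>r ^ n / fact n\<close> by
    \<open>exp r / sqrt (n + 1)\<close>. Half of \<open>u\<close> is
    \<open>\<alpha> + 3 / 4\<close>.\<close>
  define u where "u = 2 * s + 1 / 2"
  have u: "0 \<le> u" using s by (simp add: u_def)
  obtain C2 where C2: "C2 > 0"
    "\<And>r. r > 0 \<Longrightarrow> summable (\<lambda>n. r ^ n / fact n * (real n + 1) powr - u)"
    "\<And>r. r > 0 \<Longrightarrow> (\<Sum>n. r ^ n / fact n * (real n + 1) powr - u) \<le> C2 * exp r * r powr - u"
    by (rule poisson_negative_moment[OF u]) blast
  have le1: "r ^ n / dunkl_fact \<alpha> n \<le> 1 / c * (r ^ n / fact n * (real n + 1) powr - s)"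
    if "r > 0" for r n
  proof -
    have "r ^ n / dunkl_fact \<alpha> n \<le> r ^ n / (c * fact n * (real n + 1) powr s)"
      using c that by (intro divide_left_mono) (auto intro!: mult_pos_pos simp: dunkl_fact_pos)
    then show ?thesis by (simp add: powr_minus_divide)
  qed
  have le2: "(r ^ n / dunkl_fact \<alpha> n)\<^sup>2 \<le> exp r / c\<^sup>2 * (r ^ n / fact n * (real n + 1) powr - u)"
    if r: "r > 0" for r n
  proof -
    have "(r ^ n / dunkl_fact \<alpha> n)\<^sup>2 \<le> (1 / c * (r ^ n / fact n * (real n + 1) powr - s))\<^sup>2"
      using le1[OF r] r by (intro power_mono) (auto simp: dunkl_fact_pos less_imp_le)
    also have "\<dots> = 1 / c\<^sup>2 * (r ^ n / fact n * (r ^ n / fact n)) * (real n + 1) powr - (2 * s)"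
    proof -
      have "(real n + 1) powr - (2 * s) = (real n + 1) powr - s * (real n + 1) powr - s"
        by (simp flip: powr_add)
      then show ?thesis by (simp add: power2_eq_square mult_ac)
    qed
    also have "\<dots> \<le> 1 / c\<^sup>2 * (r ^ n / fact n * (exp r / sqrt (real n + 1))) * (real n + 1) powr - (2 * s)"
      using power_div_fact_le[of r n] r by (intro mult_right_mono mult_left_mono) auto
    also have "exp r / sqrt (real n + 1) = exp r * (real n + 1) powr - (1 / 2)"
      by (simp add: powr_minus_divide powr_half_sqrt)
    finally have "(r ^ n / dunkl_fact \<alpha> n)\<^sup>2 \<le> 1 / c\<^sup>2 *
        (r ^ n / fact n * (exp r * (real n + 1) powr - (1 / 2))) * (real n + 1) powr - (2 * s)" .
    also have "\<dots> = exp r / c\<^sup>2 *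
        (r ^ n / fact n * ((real n + 1) powr - (1 / 2) * (real n + 1) powr - (2 * s)))"
      by simp
    also have "(real n + 1) powr - (1 / 2) * (real n + 1) powr - (2 * s) = (real n + 1) powr - u"
    proof -
      have "- (1 / 2) + - (2 * s) = - u" by (simp add: u_def)
      then show ?thesis by (simp only: powr_add[symmetric])
    qed
    finally show ?thesis .
  qed
  define C where "C = C1 / c + sqrt (C2 / c\<^sup>2)"
  have C: "C1 / c \<le> C" "sqrt (C2 / c\<^sup>2) \<le> C" "C > 0"
    using C1(1) C2(1) c(1) by (auto simp: C_def intro!: add_pos_nonneg)
  show ?thesis
  proof (rule that)
    show "C > 0" by fact
    fix r :: real assume r: "r > 0"
    show S1: "summable (\<lambda>n. r ^ n / dunkl_fact \<alpha> n)"
      using le1[OF r] r by (intro summable_comparison_test'[OF summable_mult[OF C1(2)[OF r], of "1 / c"], of 0])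
        (auto simp: dunkl_fact_pos less_imp_le)
    have "(\<Sum>n. r ^ n / dunkl_fact \<alpha> n) \<le> (\<Sum>n. 1 / c * (r ^ n / fact n * (real n + 1) powr - s))"
      by (rule suminf_le[OF le1[OF r] S1 summable_mult[OF C1(2)[OF r]]])
    also have "\<dots> = 1 / c * (\<Sum>n. r ^ n / fact n * (real n + 1) powr - s)"
      by (rule suminf_mult[OF C1(2)[OF r]])
    also have "\<dots> \<le> 1 / c * (C1 * exp r * r powr - s)"
      using C1(3)[OF r] c by (intro mult_left_mono) auto
    also have "\<dots> = C1 / c * (exp r * r powr - s)" by simp
    also have "\<dots> \<le> C * (exp r * r powr - s)"
      using C by (intro mult_right_mono) auto
    finally show "(\<Sum>n. r ^ n / dunkl_fact \<alpha> n) \<le> C * (exp r * r powr - (\<alpha> + 1 / 2))"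
      by (simp add: s_def)
    show S2: "summable (\<lambda>n. (r ^ n / dunkl_fact \<alpha> n)\<^sup>2)"
      by (rule summable_comparison_test'[OF summable_mult[OF C2(2)[OF r], of "exp r / c\<^sup>2"], of 0])
        (simp only: real_norm_def abs_power2 le2[OF r])
    have "(\<Sum>n. (r ^ n / dunkl_fact \<alpha> n)\<^sup>2) \<le> (\<Sum>n. exp r / c\<^sup>2 * (r ^ n / fact n * (real n + 1) powr - u))"
      by (rule suminf_le[OF le2[OF r] S2 summable_mult[OF C2(2)[OF r]]])
    also have "\<dots> = exp r / c\<^sup>2 * (\<Sum>n. r ^ n / fact n * (real n + 1) powr - u)"
      by (rule suminf_mult[OF C2(2)[OF r]])
    also have "\<dots> \<le> exp r / c\<^sup>2 * (C2 * exp r * r powr - u)"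
      using C2(3)[OF r] c by (intro mult_left_mono) auto
    also have "\<dots> = C2 / c\<^sup>2 * ((exp r)\<^sup>2 * r powr - u)"
      by (simp add: power2_eq_square)
    also have "\<dots> = (sqrt (C2 / c\<^sup>2) * (exp r * r powr - (\<alpha> + 3 / 4)))\<^sup>2"
    proof -
      have "C2 / c\<^sup>2 = (sqrt (C2 / c\<^sup>2))\<^sup>2"
        by (rule real_sqrt_pow2[symmetric]) (use C2(1) in simp)
      moreover have "r powr - u = (r powr - (\<alpha> + 3 / 4))\<^sup>2"
      proof -
        have "- (\<alpha> + 3 / 4) + - (\<alpha> + 3 / 4) = - u" by (simp add: u_def s_def)
        then show ?thesis by (simp only: power2_eq_square powr_add[symmetric])
      qed
      ultimately show ?thesis
        unfolding power_mult_distrib by metis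
    qed
    also have "\<dots> \<le> (C * (exp r * r powr - (\<alpha> + 3 / 4)))\<^sup>2"
      using C C2(1) by (intro power_mono mult_right_mono) auto
    finally show "(\<Sum>n. (r ^ n / dunkl_fact \<alpha> n)\<^sup>2) \<le> (C * (exp r * r powr - (\<alpha> + 3 / 4)))\<^sup>2" .
  qed
qed

end

subsection \<open>The Dunkl operator as a weighted shift\<close>

text \<open>Termwise differentiation contributes \<open>n\<close> to each weight, and the odd part
  of \<open>f\<close> divided by \<open>z\<close> contributes \<open>2 * \<alpha> + 1\<close> for
  odd \<open>n\<close>.\<close>

lemma dunkl_power_series:
  assumes f: "\<And>z. (\<lambda>n. a n * z ^ n) sums f z"
  shows "(\<lambda>n. of_real (dunkl_weight \<alpha> (Suc n)) * a (Suc n) * z ^ n) sums dunkl \<alpha> f z"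
proof -
  define b where "b n = of_real (dunkl_weight \<alpha> (Suc n)) * a (Suc n)" for n
  define g where "g z = (\<Sum>n. b n * z ^ n)" for z
  have sa: "summable (\<lambda>n. a n * z ^ n)" for z
    using f sums_summable by blast
  have feq: "f = (\<lambda>z. \<Sum>n. a n * z ^ n)"
    using f by (auto simp: sums_iff)
  have d: "(\<lambda>n. diffs a n * z ^ n) sums deriv f z" for z
  proof -
    have "(f has_field_derivative (\<Sum>n. diffs a n * z ^ n)) (at z)"
      unfolding feq by (rule termdiffs_strong_converges_everywhere[OF sa])
    then have "deriv f z = (\<Sum>n. diffs a n * z ^ n)"
      by (rule DERIV_imp_deriv)
    then show ?thesis
      using termdiff_converges_all[of a, OF sa] by (simp add: summable_sums)
  qed
  have odd_part: "(\<lambda>n. (if odd (Suc n) then a (Suc n) else 0) * z ^ n) sums ((f z - f (- z)) / 2 / z)"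
    if z: "z \<noteq> 0" for z
  proof -
    have "(\<lambda>n. (a n * z ^ n - a n * (- z) ^ n) / 2) sums ((f z - f (- z)) / 2)"
      by (intro sums_divide sums_diff f)
    also have "(\<lambda>n. (a n * z ^ n - a n * (- z) ^ n) / 2) = (\<lambda>n. (if odd n then a n else 0) * z ^ n)"
      by (auto simp: fun_eq_iff)
    finally have "(\<lambda>n. (if odd (Suc n) then a (Suc n) else 0) * z ^ Suc n) sums ((f z - f (- z)) / 2)"
      by (subst sums_Suc_iff) simp
    from sums_divide[OF this, of z] show ?thesis using z by simp
  qed
  have bz: "(\<lambda>n. b n * z ^ n) sums (deriv f z + of_real (2 * \<alpha> + 1) / z * ((f z - f (- z)) / 2))"
    if z: "z \<noteq> 0" for z
  proof -
    have "(\<lambda>n. diffs a n * z ^ n + of_real (2 * \<alpha> + 1) * ((if odd (Suc n) then a (Suc n) else 0) * z ^ n))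
       sums (deriv f z + of_real (2 * \<alpha> + 1) * ((f z - f (- z)) / 2 / z))"
      by (intro sums_add sums_mult d odd_part z)
    moreover have "diffs a n * z ^ n + of_real (2 * \<alpha> + 1) * ((if odd (Suc n) then a (Suc n) else 0) * z ^ n)
        = b n * z ^ n" for n
      by (auto simp: b_def diffs_def dunkl_weight_def algebra_simps)
    moreover have "of_real (2 * \<alpha> + 1) * ((f z - f (- z)) / 2 / z)
        = of_real (2 * \<alpha> + 1) / z * ((f z - f (- z)) / 2)"
      by simp
    ultimately show ?thesis by (simp only:)
  qed
  have sb: "summable (\<lambda>n. b n * z ^ n)" for z
    using bz[of z] powser_sums_zero[of b] sums_summable by (cases "z = 0") blast+
  \<comment> \<open>The defining formula agrees with \<open>g\<close> only away from 0. Since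
    \<open>remove_sings\<close> takes limits and \<open>g\<close> is continuous, the value at 0 is
    also \<open>g 0\<close>.\<close>
  have "dunkl \<alpha> f z = g z"
    unfolding dunkl_def
  proof (rule remove_sings_eqI, rule Lim_transform_eventually)
    show "g \<midarrow>z\<rightarrow> g z"
      unfolding g_def using isCont_powser_converges_everywhere[of b, OF sb] by (simp add: isCont_def)
    show "\<forall>\<^sub>F w in at z. g w = deriv f w + of_real (2 * \<alpha> + 1) / w * ((f w - f (- w)) / 2)"
      using eventually_neq_at_within[of 0 z UNIV]
      by eventually_elim (use bz in \<open>simp add: g_def sums_iff\<close>)
  qed
  then show ?thesis
    using sb[of z] by (simp add: g_def b_def summable_sums)
qed

text \<open>Dividing by \<open>dunkl_fact\<close> cancels the weights, so the operator acts on
  \<open>b\<close> as the unweighted backward shift.\<close>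

lemma dunkl_funpow_power_series:
  assumes \<alpha>: "\<alpha> > - 1 / 2"
    and f: "\<And>z. (\<lambda>n. b n / of_real (dunkl_fact \<alpha> n) * z ^ n) sums f z"
  shows "(\<lambda>n. b (n + m) / of_real (dunkl_fact \<alpha> n) * z ^ n) sums (dunkl \<alpha> ^^ m) f z"
proof (induction m arbitrary: z)
  case 0
  show ?case using f by simp
next
  case (Suc m)
  have "of_real (dunkl_weight \<alpha> (Suc n)) * (b (Suc n + m) / of_real (dunkl_fact \<alpha> (Suc n)))
      = b (n + Suc m) / of_real (dunkl_fact \<alpha> n)" for n
    using dunkl_weight_Suc_pos[OF \<alpha>, of n] by (simp add: dunkl_fact_Suc)
  then show ?case
    using dunkl_power_series[OF Suc, of \<alpha> z] by simp
qed

subsection \<open>Integral means\<close>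

lemma has_integral_exp_int_circle:
  fixes k :: int
  assumes "k \<noteq> 0"
  shows "((\<lambda>t. exp (\<i> * of_int k * of_real t)) has_integral 0) {0..2 * pi}"
proof -
  have "((\<lambda>t. exp (\<i> * of_int k * of_real t)) has_integral
      exp (\<i> * of_int k * of_real (2 * pi)) / (\<i> * of_int k)
      - exp (\<i> * of_int k * of_real 0) / (\<i> * of_int k)) {0..2 * pi}"
  proof (rule fundamental_theorem_of_calculus)
    fix t :: real
    have "((\<lambda>z. exp (\<i> * of_int k * z) / (\<i> * of_int k)) has_field_derivative
        exp (\<i> * of_int k * of_real t)) (at (of_real t))"
      using assms by (auto intro!: derivative_eq_intros)
    then show "((\<lambda>t. exp (\<i> * of_int k * of_real t) / (\<i> * of_int k)) has_vector_derivative
        exp (\<i> * of_int k * of_real t)) (at t within {0..2 * pi})"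
      by (rule has_vector_derivative_real_field)
  qed simp
  moreover have "exp (\<i> * of_int k * of_real (2 * pi)) = 1"
    using exp_integer_2pi[of "of_int k"] by (simp add: mult_ac)
  ultimately show ?thesis by simp
qed

text \<open>Adding the term of index \<open>N\<close> creates a cross term that combines
  exponentials of the nonzero frequencies \<open>n - N\<close>; its integral vanishes.\<close>

lemma has_integral_norm_sq_trig_poly:
  fixes c :: "nat \<Rightarrow> complex"
  shows "((\<lambda>t. (norm (\<Sum>n<N. c n * exp (\<i> * of_real t) ^ n))\<^sup>2) has_integral
    2 * pi * (\<Sum>n<N. (norm (c n))\<^sup>2)) {0..2 * pi}"
proof (induction N)
  case 0
  show ?case by simp
next
  case (Suc N)
  define S where "S t = (\<Sum>n<N. c n * exp (\<i> * of_real t) ^ n)" for t :: real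
  define X where "X t = (\<Sum>n<N. c n * cnj (c N) * exp (\<i> * of_int (int n - int N) * of_real t))"
    for t :: real
  have "(X has_integral (\<Sum>n<N. c n * cnj (c N) * 0)) {0..2 * pi}"
    unfolding X_def
    by (intro has_integral_sum has_integral_mult_right has_integral_exp_int_circle) auto
  then have "(X has_integral 0) {0..2 * pi}" by simp
  from has_integral_linear[OF this bounded_linear_Re]
  have X: "((\<lambda>t. Re (X t)) has_integral 0) {0..2 * pi}" by (simp add: o_def)
  have XS: "X t = S t * cnj (c N * exp (\<i> * of_real t) ^ N)" for t
  proof -
    have E: "exp (\<i> * of_int (int n - int N) * of_real t)
        = exp (\<i> * of_real t) ^ n * cnj (exp (\<i> * of_real t) ^ N)" for n
    proof -
      have "cnj (exp (\<i> * of_real t)) = exp (- (\<i> * of_real t))" by (simp add: exp_cnj)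
      then have "exp (\<i> * of_real t) ^ n * cnj (exp (\<i> * of_real t) ^ N)
          = exp (of_nat n * (\<i> * of_real t)) * exp (of_nat N * (- (\<i> * of_real t)))"
        by (simp only: complex_cnj_power exp_of_nat_mult)
      also have "\<dots> = exp (\<i> * of_int (int n - int N) * of_real t)"
        unfolding exp_add[symmetric] by (simp add: algebra_simps)
      finally show ?thesis by simp
    qed
    show ?thesis
      unfolding X_def S_def sum_distrib_right E complex_cnj_mult by (simp only: mult_ac)
  qed
  have eq: "(norm (\<Sum>n<Suc N. c n * exp (\<i> * of_real t) ^ n))\<^sup>2
      = (norm (S t))\<^sup>2 + (norm (c N))\<^sup>2 + 2 * Re (X t)" for t
  proof -
    have "(norm (u + v))\<^sup>2 = (norm u)\<^sup>2 + (norm v)\<^sup>2 + 2 * Re (u * cnj v)" for u v :: complex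
      unfolding cmod_power2 by (simp add: power2_eq_square algebra_simps)
    from this[of "S t" "c N * exp (\<i> * of_real t) ^ N"] show ?thesis
      by (simp add: S_def XS norm_mult norm_power)
  qed
  have "((\<lambda>t. (norm (S t))\<^sup>2 + (norm (c N))\<^sup>2 + 2 * Re (X t)) has_integral
     2 * pi * (\<Sum>n<N. (norm (c n))\<^sup>2) + (2 * pi - 0) *\<^sub>R (norm (c N))\<^sup>2 + 2 * 0) {0..2 * pi}"
    using Suc unfolding S_def[symmetric]
    by (intro has_integral_add has_integral_mult_right X)
      (use has_integral_const_real[of "(norm (c N))\<^sup>2" 0 "2 * pi"] in auto)
  then show ?case unfolding eq by (simp add: algebra_simps)
qed

text \<open>Parseval's identity, from the polynomial case by dominated convergence: the sum of
  \<open>norm (a n) * r ^ n\<close> bounds all partial sums on the circle.\<close>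

lemma has_integral_norm_sq_circle:
  fixes a :: "nat \<Rightarrow> complex"
  assumes sm: "summable (\<lambda>n. norm (a n) * r ^ n)" and r: "0 \<le> r"
    and f: "\<And>z. norm z = r \<Longrightarrow> (\<lambda>n. a n * z ^ n) sums f z"
  shows "((\<lambda>t. (norm (f (of_real r * exp (\<i> * of_real t))))\<^sup>2) has_integral
    2 * pi * (\<Sum>n. (norm (a n) * r ^ n)\<^sup>2)) {0..2 * pi}"
proof -
  define S where "S N t = (\<Sum>n<N. a n * of_real r ^ n * exp (\<i> * of_real t) ^ n)" for N t
  define F where "F t = f (of_real r * exp (\<i> * of_real t))" for t :: real
  define J where "J N = 2 * pi * (\<Sum>n<N. (norm (a n) * r ^ n)\<^sup>2)" for N
  have SJ: "((\<lambda>t. (norm (S N t))\<^sup>2) has_integral J N) {0..2 * pi}" for N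
    using has_integral_norm_sq_trig_poly[where N = N and c = "\<lambda>n. a n * of_real r ^ n"] r
    by (simp add: S_def J_def norm_mult norm_power)
  have lim: "(\<lambda>N. S N t) \<longlonglongrightarrow> F t" for t
    using f[of "of_real r * exp (\<i> * of_real t)"] r
    by (simp add: S_def F_def sums_def norm_mult power_mult_distrib mult_ac)
  have bd: "norm (S N t) \<le> (\<Sum>n. norm (a n) * r ^ n)" for N t
  proof -
    have "norm (S N t) \<le> (\<Sum>n<N. norm (a n) * r ^ n)"
      unfolding S_def using r by (intro sum_norm_le) (simp add: norm_mult norm_power)
    also have "\<dots> \<le> (\<Sum>n. norm (a n) * r ^ n)"
      using r by (intro sum_le_suminf sm) auto
    finally show ?thesis .
  qed
  have dc: "(\<lambda>t. (norm (F t))\<^sup>2) integrable_on {0..2 * pi}"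
    "(\<lambda>N. integral {0..2 * pi} (\<lambda>t. (norm (S N t))\<^sup>2))
      \<longlonglongrightarrow> integral {0..2 * pi} (\<lambda>t. (norm (F t))\<^sup>2)"
  proof -
    have "(\<lambda>t. (norm (S N t))\<^sup>2) integrable_on {0..2 * pi}" for N using SJ by blast
    moreover have "(\<lambda>t::real. (\<Sum>n. norm (a n) * r ^ n)\<^sup>2) integrable_on {0..2 * pi}"
      by (rule integrable_const_ivl)
    moreover have "norm ((norm (S N t))\<^sup>2) \<le> (\<Sum>n. norm (a n) * r ^ n)\<^sup>2" for N t
      using bd by (simp add: power_mono)
    moreover have "(\<lambda>N. (norm (S N t))\<^sup>2) \<longlonglongrightarrow> (norm (F t))\<^sup>2" for t
      by (intro tendsto_intros lim)
    ultimately show "(\<lambda>t. (norm (F t))\<^sup>2) integrable_on {0..2 * pi}"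
      "(\<lambda>N. integral {0..2 * pi} (\<lambda>t. (norm (S N t))\<^sup>2))
        \<longlonglongrightarrow> integral {0..2 * pi} (\<lambda>t. (norm (F t))\<^sup>2)"
      using dominated_convergence[where f = "\<lambda>N t. (norm (S N t))\<^sup>2" and S = "{0..2 * pi}"
          and g = "\<lambda>t. (norm (F t))\<^sup>2" and h = "\<lambda>t. (\<Sum>n. norm (a n) * r ^ n)\<^sup>2"]
      by blast+
  qed
  have "(\<lambda>N. integral {0..2 * pi} (\<lambda>t. (norm (S N t))\<^sup>2)) = J"
    by (rule ext) (rule integral_unique[OF SJ])
  with dc(2) have "J \<longlonglongrightarrow> integral {0..2 * pi} (\<lambda>t. (norm (F t))\<^sup>2)"
    by simp
  then have "(\<lambda>N. J N / (2 * pi)) \<longlonglongrightarrow> integral {0..2 * pi} (\<lambda>t. (norm (F t))\<^sup>2) / (2 * pi)"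
    by (rule tendsto_divide) auto
  then have "(\<lambda>n. (norm (a n) * r ^ n)\<^sup>2) sums (integral {0..2 * pi} (\<lambda>t. (norm (F t))\<^sup>2) / (2 * pi))"
    by (simp add: J_def sums_def)
  then have "integral {0..2 * pi} (\<lambda>t. (norm (F t))\<^sup>2) = 2 * pi * (\<Sum>n. (norm (a n) * r ^ n)\<^sup>2)"
    by (simp add: sums_iff)
  then show ?thesis
    using dc(1) by (simp add: F_def has_integral_iff)
qed

text \<open>Interpolation between the sup norm and the quadratic mean for \<open>p > 2\<close>, comparison with the
  quadratic mean for \<open>p \<le> 2\<close>; the factor \<open>2\<close> avoids Hoelder's inequality.\<close>

lemma integral_mean_le:
  fixes A q r :: real and p :: ereal
  assumes p: "1 \<le> p" and r: "0 \<le> r" and A: "0 < A" and q: "0 < q"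
    and cont: "continuous_on (sphere 0 r) f"
    and sup: "\<And>z. norm z = r \<Longrightarrow> norm (f z) \<le> A"
    and sq: "integral {0..2 * pi} (\<lambda>t. (norm (f (of_real r * exp (\<i> * of_real t))))\<^sup>2)
       \<le> 2 * pi * (A * q)\<^sup>2"
  shows "integral_mean p f r \<le> 2 * A * q powr (4 * real_of_ereal (1 / (2 * max 2 p)))"
proof (cases p)
  \<comment> \<open>The exponent of \<open>q\<close> is 0 in this case, so the factor is 1.\<close>
  case PInf
  have "integral_mean p f r \<le> A"
    unfolding integral_mean_def PInf using sup r by (auto intro!: cSUP_least simp: dist_norm)
  then show ?thesis using A q PInf by simp
next
  case MInf
  then show ?thesis using p by simp
next
  case (real s)
  have s: "1 \<le> s" using p real by simp
  define F where "F t = norm (f (of_real r * exp (\<i> * of_real t)))" for t :: real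
  have F0: "0 \<le> F t" for t by (simp add: F_def)
  have FA: "F t \<le> A" for t using r by (auto simp: F_def norm_mult intro!: sup)
  have cF: "continuous_on {0..2 * pi} F"
    unfolding F_def using r
    by (intro continuous_on_norm continuous_on_compose2[OF cont] continuous_intros)
      (auto simp: norm_mult dist_norm)
  have i2: "(\<lambda>t. (F t)\<^sup>2) integrable_on {0..2 * pi}"
    by (intro integrable_continuous_interval continuous_intros cF)
  have ips: "(\<lambda>t. F t powr s) integrable_on {0..2 * pi}"
    using s F0 by (intro integrable_continuous_interval continuous_on_powr' cF continuous_intros) auto
  have sq': "integral {0..2 * pi} (\<lambda>t. (F t)\<^sup>2) \<le> 2 * pi * (A * q)\<^sup>2"
    using sq by (simp add: F_def)
  have m: "integral_mean p f r = (1 / (2 * pi) * integral {0..2 * pi} (\<lambda>t. F t powr s)) powr (1 / s)"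
    by (simp add: integral_mean_def real F_def)
  have m0: "0 \<le> 1 / (2 * pi) * integral {0..2 * pi} (\<lambda>t. F t powr s)"
    using integral_nonneg[OF ips] by simp
  show ?thesis
  proof (cases "s \<le> 2")
    case True
    \<comment> \<open>After scaling by the bound \<open>B\<close> for the quadratic mean,
      \<open>x powr s \<le> 1 + x\<^sup>2\<close> gives mean at most \<open>2 * B powr s\<close>;
      the root turns 2 into at most 2 because \<open>s \<ge> 1\<close>.\<close>
    define B where "B = A * q"
    have B: "B > 0" using A q by (simp add: B_def)
    have "F t powr s \<le> B powr s * (1 + (F t)\<^sup>2 / B\<^sup>2)" for t
    proof -
      define x where "x = F t / B"
      have x: "x \<ge> 0" using B F0 by (simp add: x_def)
      have "x powr s \<le> 1 + x\<^sup>2"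
      proof (cases "x \<le> 1")
        case True
        then have "x powr s \<le> 1" using x s by (simp add: powr_le1)
        then show ?thesis by (simp add: add_increasing2)
      next
        case False
        then have "x powr s \<le> x powr 2" using \<open>s \<le> 2\<close> by (intro powr_mono) auto
        then show ?thesis using False by simp
      qed
      moreover have "F t powr s = B powr s * x powr s"
        using B F0 by (simp add: x_def flip: powr_mult)
      ultimately show ?thesis using B by (simp add: x_def power_divide mult_left_mono)
    qed
    then have "integral {0..2 * pi} (\<lambda>t. F t powr s)
        \<le> integral {0..2 * pi} (\<lambda>t. B powr s * (1 + (F t)\<^sup>2 / B\<^sup>2))"
      by (intro integral_le ips integrable_continuous_interval continuous_intros cF) (use B in auto)
    also have "\<dots> = B powr s * (2 * pi + integral {0..2 * pi} (\<lambda>t. (F t)\<^sup>2) / B\<^sup>2)"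
      using i2 by (subst integral_mult_right, subst integral_add) (auto intro: integrable_on_divide)
    also have "\<dots> \<le> B powr s * (2 * pi + 2 * pi)"
      using sq' B by (intro mult_left_mono add_left_mono) (auto simp: B_def[symmetric] field_simps)
    finally have "1 / (2 * pi) * integral {0..2 * pi} (\<lambda>t. F t powr s) \<le> 2 * B powr s"
      by (simp add: field_simps)
    then have "integral_mean p f r \<le> (2 * B powr s) powr (1 / s)"
      unfolding m using m0 s by (intro powr_mono2) auto
    also have "\<dots> = 2 powr (1 / s) * B"
      using B s by (simp add: powr_mult powr_powr)
    also have "\<dots> \<le> 2 powr 1 * B"
      using B s by (intro mult_right_mono powr_mono) auto
    also have "\<dots> = 2 * A * q powr (4 * real_of_ereal (1 / (2 * max 2 p)))"
      using True q by (simp add: B_def real max_def one_ereal_def)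
    finally show ?thesis .
  next
    case False
    have "F t powr s \<le> A powr (s - 2) * (F t)\<^sup>2" for t
    proof (cases "F t = 0")
      case False
      then have pos: "F t > 0" using F0[of t] by linarith
      have "F t powr s = F t powr (s - 2) * F t powr 2"
        by (simp flip: powr_add)
      also have "\<dots> = F t powr (s - 2) * (F t)\<^sup>2" using pos by simp
      also have "\<dots> \<le> A powr (s - 2) * (F t)\<^sup>2"
        using \<open>\<not> s \<le> 2\<close> FA F0 by (intro mult_right_mono powr_mono2) auto
      finally show ?thesis .
    qed simp
    then have "integral {0..2 * pi} (\<lambda>t. F t powr s)
        \<le> integral {0..2 * pi} (\<lambda>t. A powr (s - 2) * (F t)\<^sup>2)"
      by (intro integral_le ips integrable_on_mult_right i2)
    also have "\<dots> = A powr (s - 2) * integral {0..2 * pi} (\<lambda>t. (F t)\<^sup>2)" by simp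
    also have "\<dots> \<le> A powr (s - 2) * (2 * pi * (A * q)\<^sup>2)"
      using sq' by (intro mult_left_mono) auto
    also have "A powr (s - 2) * (2 * pi * (A * q)\<^sup>2) = 2 * pi * (A powr s * q powr 2)"
      using A q by (simp add: powr_diff power_mult_distrib)
    finally have "1 / (2 * pi) * integral {0..2 * pi} (\<lambda>t. F t powr s) \<le> A powr s * q powr 2"
      by (simp add: field_simps)
    then have "integral_mean p f r \<le> (A powr s * q powr 2) powr (1 / s)"
      unfolding m using m0 s by (intro powr_mono2) auto
    also have "\<dots> = A * q powr (2 / s)"
      unfolding powr_mult powr_powr using A s by simp
    also have "\<dots> \<le> 2 * A * q powr (2 / s)"
      using A by simp
    \<comment> \<open>The factor 4 is a normalisation: \<open>q\<close> will be
      \<open>r powr - (1 / 4)\<close>, so that \<open>q powr (4 * w)\<close> becomes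
      \<open>r powr - w\<close>.\<close>
    also have "2 / s = 4 * real_of_ereal (1 / (2 * max 2 p))"
      using False by (simp add: real max_def one_ereal_def)
    finally show ?thesis .
  qed
qed

subsection \<open>Universal sequences\<close>

lemma finite_upto: "finite {n \<in> A. 1 \<le> n \<and> n \<le> (N::nat)}"
  by (rule finite_subset[of _ "{..N}"]) auto

lemma lower_density_mono:
  assumes "A \<subseteq> B"
  shows "lower_density A \<le> lower_density B"
  unfolding lower_density_def
proof (intro Liminf_mono always_eventually allI)
  fix N
  have "card {n \<in> A. 1 \<le> n \<and> n \<le> N} \<le> card {n \<in> B. 1 \<le> n \<and> n \<le> N}"
    using assms by (intro card_mono finite_upto) auto
  then show "ereal (real (card {n \<in> A. 1 \<le> n \<and> n \<le> N}) / real N)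
      \<le> ereal (real (card {n \<in> B. 1 \<le> n \<and> n \<le> N}) / real N)"
    by (simp add: divide_right_mono)
qed

text \<open>The first \<open>N div M\<close> values of \<open>g\<close> lie in \<open>1..N\<close>,
  and \<open>N div M\<close> is at least \<open>N / (2 * M)\<close> once
  \<open>N \<ge> M\<close>.\<close>

lemma lower_density_range_pos:
  fixes g :: "nat \<Rightarrow> nat"
  assumes "inj g" and g: "\<And>j. 1 \<le> g j" "\<And>j. g j \<le> M * Suc j"
  shows "lower_density (range g) > 0"
proof -
  have M: "M > 0" using g(1,2)[of 0] by (cases M) auto
  have "1 / (2 * real M) \<le> real (card {n \<in> range g. 1 \<le> n \<and> n \<le> N}) / real N" if N: "N \<ge> M" for N
  proof -
    have "g ` {..<N div M} \<subseteq> {n \<in> range g. 1 \<le> n \<and> n \<le> N}"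
    proof clarify
      fix j assume "j < N div M"
      then have "M * Suc j \<le> M * (N div M)" by (intro mult_left_mono) auto
      also have "\<dots> \<le> N" by simp
      finally show "g j \<in> range g \<and> 1 \<le> g j \<and> g j \<le> N" using g order_trans by blast
    qed
    then have "card (g ` {..<N div M}) \<le> card {n \<in> range g. 1 \<le> n \<and> n \<le> N}"
      by (intro card_mono finite_upto)
    then have 1: "N div M \<le> card {n \<in> range g. 1 \<le> n \<and> n \<le> N}"
      using assms(1) by (simp add: card_image inj_on_subset[OF _ subset_UNIV])
    have "N div M \<ge> 1" using N M by (simp add: div_greater_zero_iff Suc_leI)
    then have "M \<le> M * (N div M)" by simp
    moreover have "N < M * (N div M) + M"
      using M mod_less_divisor[OF M, of N] mult_div_mod_eq[of M N] by linarith
    ultimately have "N \<le> 2 * M * (N div M)" by linarith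
    also have "\<dots> \<le> 2 * M * card {n \<in> range g. 1 \<le> n \<and> n \<le> N}" using 1 by (intro mult_left_mono) auto
    finally have "real N \<le> real (2 * M * card {n \<in> range g. 1 \<le> n \<and> n \<le> N})"
      by (rule of_nat_mono)
    then show ?thesis using N M by (simp add: field_simps)
  qed
  then have "ereal (1 / (2 * real M)) \<le> lower_density (range g)"
    unfolding lower_density_def
    by (intro Liminf_bounded) (auto simp: eventually_sequentially intro!: exI[of _ M])
  moreover have "0 < ereal (1 / (2 * real M))" using M by simp
  ultimately show ?thesis by (rule less_le_trans[rotated])
qed

text \<open>The \<open>k\<close>-th block has level \<open>block_level k\<close>, which bounds its length; it is separated from
  its neighbours by gaps that are at least as long as its level. Each level occurs with positive
  density, and the average level is finite.\<close>

definition block_level :: "nat \<Rightarrow> nat" where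
  "block_level k = multiplicity 2 k"

text \<open>Block \<open>k\<close> has a slot of length \<open>2 * block_level k + 1\<close>: an
  idle run of length \<open>block_level k\<close>, then the block, then one spare position that
  makes the starts strictly increasing.\<close>

definition block_start :: "nat \<Rightarrow> nat" where
  "block_start k = block_level k + (\<Sum>i<k. 2 * block_level i + 1)"

lemma block_level_odd: "odd k \<Longrightarrow> block_level k = 0"
  by (simp add: block_level_def not_dvd_imp_multiplicity_0)

lemma block_level_double: "0 < k \<Longrightarrow> block_level (2 * k) = Suc (block_level k)"
  by (simp add: block_level_def multiplicity_times_same)

lemma block_level_power2: "block_level (2 ^ l * (2 * j + 1)) = l"
proof (induction l)
  case 0
  show ?case by (simp add: block_level_odd)
next
  case (Suc l)
  then show ?case
    using block_level_double[of "2 ^ l * (2 * j + 1)"] by (simp add: mult.assoc)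
qed

lemma sum_block_level_double:
  "(\<Sum>i=1..2 * n. block_level i) = n + (\<Sum>i=1..n. block_level i)"
proof (induction n)
  case (Suc n)
  have "(\<Sum>i=1..2 * Suc n. block_level i)
      = (\<Sum>i=1..2 * n. block_level i) + block_level (2 * n + 1) + block_level (2 * Suc n)"
    by simp
  also have "\<dots> = Suc n + (\<Sum>i=1..Suc n. block_level i)"
    unfolding Suc.IH block_level_double[OF zero_less_Suc] by (simp add: block_level_odd)
  finally show ?case .
qed simp

text \<open>The sum is the 2-adic valuation of \<open>fact n\<close>. Odd indices contribute
  nothing, so halving \<open>n\<close> costs \<open>n div 2\<close>, and the induction closes with
  \<open>2 * (n div 2) \<le> n\<close>.\<close>

lemma sum_block_level_le: "(\<Sum>i=1..n. block_level i) \<le> n"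
proof (induction n rule: less_induct)
  case (less n)
  show ?case
  proof (cases "n = 0")
    case False
    then have IH: "(\<Sum>i=1..n div 2. block_level i) \<le> n div 2" by (intro less) auto
    show ?thesis
    proof (cases "even n")
      case True
      then show ?thesis using sum_block_level_double[of "n div 2"] IH by simp
    next
      case False
      then obtain k where k: "n = Suc (2 * k)" by (auto elim: oddE)
      have "(\<Sum>i=1..n. block_level i) = (\<Sum>i=1..2 * k. block_level i) + block_level n"
        by (simp add: k)
      then show ?thesis
        using False sum_block_level_double[of k] IH by (simp add: k block_level_odd)
    qed
  qed simp
qed

text \<open>Linear growth of the starts is what makes the density of every level positive.\<close>

lemma block_start_le: "block_start k \<le> 4 * k"
proof (cases k)
  case 0
  then show ?thesis by (simp add: block_start_def block_level_def)
next
  case (Suc n)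
  \<comment> \<open>The index 0 may be dropped because \<open>multiplicity 2 0\<close> is 0.\<close>
  have "(\<Sum>i<k. block_level i) = (\<Sum>i=1..n. block_level i)"
    by (intro sum.mono_neutral_right) (auto simp: Suc block_level_def Suc_le_eq)
  moreover have "(\<Sum>i=1..k. block_level i) = (\<Sum>i=1..n. block_level i) + block_level k"
    by (simp add: Suc)
  moreover have "(\<Sum>i<k. 2 * block_level i + 1) = 2 * (\<Sum>i<k. block_level i) + k"
    unfolding sum.distrib by (simp add: sum_distrib_left)
  ultimately have "block_start k \<le> 2 * (\<Sum>i=1..k. block_level i) + k"
    unfolding block_start_def by linarith
  then show ?thesis using sum_block_level_le[of k] by linarith
qed

lemma block_start_gap:
  assumes "k < k'"
  shows "block_start k + block_level k + block_level k' < block_start k'"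
proof -
  have "(\<Sum>i<Suc k. 2 * block_level i + 1) \<le> (\<Sum>i<k'. 2 * block_level i + 1)"
    using assms by (intro sum_mono2) auto
  then show ?thesis by (simp add: block_start_def)
qed

text \<open>The indices \<open>2 ^ l * (2 * j + 1)\<close> all have level \<open>l\<close>, and
  their starts grow linearly in \<open>j\<close>.\<close>

lemma lower_density_block_starts: "lower_density {block_start k |k. block_level k = l} > 0"
proof -
  define g where "g j = block_start (2 ^ l * (2 * j + 1))" for j
  have "strict_mono block_start"
    by (rule strict_monoI) (use block_start_gap in fastforce)
  then have "inj g"
    unfolding g_def by (intro injI) (simp add: strict_mono_eq)
  moreover have "1 \<le> g j" for j
    using block_start_gap[of 0 "2 ^ l * (2 * j + 1)"] by (simp add: g_def)
  moreover have "g j \<le> (8 * 2 ^ l) * Suc j" for j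
    using block_start_le[of "2 ^ l * (2 * j + 1)"] by (simp add: g_def algebra_simps)
  ultimately have "lower_density (range g) > 0"
    by (rule lower_density_range_pos)
  also have "lower_density (range g) \<le> lower_density {block_start k |k. block_level k = l}"
    using block_level_power2 by (intro lower_density_mono) (auto simp: g_def)
  finally show ?thesis .
qed

lemma block_unique:
  assumes "block_start k + j = block_start k' + j'" "j < block_level k" "j' < block_level k'"
  shows "k = k'"
  using block_start_gap[of k k'] block_start_gap[of k' k] assms by (cases rule: linorder_cases[of k k']) linarith+

text \<open>By \<open>block_unique\<close> the index set has at most one element; the sum merely
  selects the letter of the block covering \<open>m\<close>, or 0 in a gap.\<close>

definition block_sequence :: "(nat \<Rightarrow> nat \<Rightarrow> 'a::comm_monoid_add) \<Rightarrow> nat \<Rightarrow> 'a" where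
  "block_sequence W m =
     (\<Sum>k | block_start k \<le> m \<and> m < block_start k + block_level k. W (block_level k) (m - block_start k))"

lemma block_sequence_inside:
  assumes "j < block_level k"
  shows "block_sequence W (block_start k + j) = W (block_level k) j"
proof -
  have "{k'. block_start k' \<le> block_start k + j \<and> block_start k + j < block_start k' + block_level k'} = {k}"
    (is "?S = _")
  proof (intro equalityI subsetI)
    fix k' assume "k' \<in> ?S"
    then have "block_start k + j = block_start k' + (block_start k + j - block_start k')"
      "block_start k + j - block_start k' < block_level k'"
      by auto
    then show "k' \<in> {k}" using block_unique assms by blast
  qed (use assms in auto)
  then show ?thesis by (simp add: block_sequence_def)
qed

lemma block_sequence_cases:
  obtains "block_sequence W m = 0"
  | k j where "m = block_start k + j" "j < block_level k" "block_sequence W m = W (block_level k) j"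
proof (cases "\<exists>k. block_start k \<le> m \<and> m < block_start k + block_level k")
  case True
  then obtain k where k: "block_start k \<le> m" "m < block_start k + block_level k" by blast
  then show ?thesis
    using block_sequence_inside[of "m - block_start k" k W] that(2)[of k "m - block_start k"] by simp
next
  case False
  then have "{k. block_start k \<le> m \<and> m < block_start k + block_level k} = {}" by blast
  then have "block_sequence W m = 0" by (simp only: block_sequence_def sum.empty)
  then show ?thesis by (rule that(1))
qed

text \<open>A later block is preceded by an idle run as long as its level. If it is met at distance
  \<open>j\<close> from \<open>block_start k\<close>, its level, and hence its letters, are at most
  \<open>j\<close>. This bounds the tail independently of \<open>k\<close>.\<close>

lemma norm_block_sequence_after:
  fixes W :: "nat \<Rightarrow> nat \<Rightarrow> 'a::real_normed_vector"
  assumes W: "\<And>l j. norm (W l j) \<le> real l" and j: "block_level k \<le> j"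
  shows "norm (block_sequence W (block_start k + j)) \<le> real j"
proof (cases rule: block_sequence_cases[of W "block_start k + j"])
  case (2 k' j')
  consider "k' = k" | "k' < k" | "k < k'" by linarith
  then show ?thesis
  proof cases
    case 1
    then show ?thesis using 2 j by simp
  next
    case c: 2
    then show ?thesis using block_start_gap[OF c] 2 by linarith
  next
    case 3
    then have "block_level k' \<le> j" using block_start_gap[OF 3] 2 by linarith
    then show ?thesis using W[of "block_level k'" j'] 2(3) by simp
  qed
qed simp

text \<open>Blocks of level \<open>l\<close> carry the word coded by \<open>l\<close>, with letters
  in a countable dense set. The word approximating \<open>c\<close> has codes \<open>l\<close>
  beyond any \<open>L\<close>, and its block is padded by zeros up to length \<open>l\<close>, so
  the uncontrolled part starts as late as desired.\<close>

lemma universal_sequence: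
  fixes h :: "nat \<Rightarrow> real"
  assumes h: "mono h" "filterlim h at_top sequentially" "\<And>n. 0 \<le> h n"
  obtains b :: "nat \<Rightarrow> complex" where
    "\<And>n. norm (b n) \<le> h n"
    "\<And>c N L \<epsilon>. \<epsilon> > 0 \<Longrightarrow> \<exists>A l. L \<le> l \<and> lower_density A > 0 \<and>
        (\<forall>n\<in>A. (\<forall>j<N. norm (b (n + j) - c j) < \<epsilon>) \<and> (\<forall>j\<ge>N. j < l \<longrightarrow> b (n + j) = 0) \<and>
          (\<forall>j\<ge>l. norm (b (n + j)) \<le> real j))"
proof -
  obtain D :: "complex set" where D: "countable D" "\<And>X. open X \<Longrightarrow> X \<noteq> {} \<Longrightarrow> \<exists>d\<in>D. d \<in> X"
    by (rule countable_dense_setE) blast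
  have "D \<noteq> {}" using D(2)[of UNIV] by auto
  define q where "q = from_nat_into D"
  have q: "\<exists>i. norm (q i - z) < \<epsilon>" if \<epsilon>: "\<epsilon> > 0" for z \<epsilon>
  proof -
    obtain d where "d \<in> D" "d \<in> ball z \<epsilon>" 
      using D(2)[of "ball z \<epsilon>"] \<epsilon> by (metis open_ball ball_eq_empty not_le)
    moreover obtain i where "q i = d"
      using from_nat_into_surj[OF D(1) \<open>d \<in> D\<close>] unfolding q_def by blast
    ultimately show ?thesis by (auto simp: dist_norm norm_minus_commute)
  qed
  \<comment> \<open>The discarded second component makes every word occur for infinitely many
    \<open>l\<close>.\<close>
  define word where "word l = fst (from_nat l :: nat list \<times> nat)" for l
  \<comment> \<open>Words too long or too large for their level are replaced by zeros; each fixed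
    word is good from some level on.\<close>
  define good where "good l xs \<longleftrightarrow> length xs \<le> l \<and> (\<forall>i\<in>set xs. norm (q i) \<le> min (real l) (h l))" for l xs
  define W where "W l j = (if j < length (word l) \<and> good l (word l) then q (word l ! j) else 0)" for l j
  have W: "norm (W l j) \<le> min (real l) (h l)" for l j
    using h(3) by (auto simp: W_def good_def)
  define b where "b = block_sequence W"
  show ?thesis
  proof (rule that[of b])
    fix m
    show "norm (b m) \<le> h m"
    proof (cases rule: block_sequence_cases[of W m])
      case (2 k j)
      \<comment> \<open>A block starts no earlier than its level, so monotonicity of
        \<open>h\<close> transfers the bound from the level to the position.\<close>
      then have "block_level k \<le> m" by (simp add: block_start_def)
      then have "h (block_level k) \<le> h m" using h(1) by (simp add: monoD)
      then show ?thesis using W[of "block_level k" j] 2 by (simp add: b_def)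
    qed (use h(3) in \<open>simp add: b_def\<close>)
  next
    fix c :: "nat \<Rightarrow> complex" and N L :: nat and \<epsilon> :: real assume \<epsilon>: "\<epsilon> > 0"
    have "\<forall>j. \<exists>i. norm (q i - c j) < \<epsilon>" using q[OF \<epsilon>] by blast
    from choice[OF this] obtain i where i: "\<And>j. norm (q (i j) - c j) < \<epsilon>" by blast
    define xs where "xs = map i [0..<N]"
    have "\<forall>\<^sub>F l in sequentially. good l xs"
    proof -
      have "\<forall>\<^sub>F l in sequentially. norm (q i) \<le> min (real l) (h l)" for i
        using filterlim_real_sequentially h(2) by (auto simp: filterlim_at_top intro: eventually_conj)
      then show ?thesis
        unfolding good_def by (intro eventually_conj eventually_ge_at_top eventually_ball_finite) auto
    qed
    then obtain L' where L': "\<And>l. l \<ge> L' \<Longrightarrow> good l xs" by (auto simp: eventually_sequentially)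
    have "infinite (range (\<lambda>k::nat. to_nat (xs, k)))"
      by (rule range_inj_infinite) (auto intro!: injI)
    then obtain l where l: "l \<in> range (\<lambda>k::nat. to_nat (xs, k))" "l \<ge> max L L'"
      unfolding infinite_nat_iff_unbounded_le by blast
    then have wl: "word l = xs" by (auto simp: word_def)
    have gl: "good l xs" using L' l(2) by simp
    then have Nl: "N \<le> l" by (simp add: good_def xs_def)
    have Wl: "W l j = (if j < N then q (i j) else 0)" for j
      using gl by (simp add: W_def wl xs_def)
    have "(\<forall>j<N. norm (b (n + j) - c j) < \<epsilon>) \<and> (\<forall>j\<ge>N. j < l \<longrightarrow> b (n + j) = 0) \<and>
          (\<forall>j\<ge>l. norm (b (n + j)) \<le> real j)" if n: "n \<in> {block_start k |k. block_level k = l}" for n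
    proof -
      obtain k where k: "n = block_start k" "block_level k = l" using n by blast
      have "b (n + j) = W l j" if "j < l" for j
        using block_sequence_inside[of j k W] k that by (simp add: b_def)
      moreover have "norm (b (n + j)) \<le> real j" if "j \<ge> l" for j
        using norm_block_sequence_after[of W k j] W k that by (simp add: b_def)
      ultimately show ?thesis using Wl Nl i by auto
    qed
    then show "\<exists>A l. L \<le> l \<and> lower_density A > 0 \<and>
        (\<forall>n\<in>A. (\<forall>j<N. norm (b (n + j) - c j) < \<epsilon>) \<and> (\<forall>j\<ge>N. j < l \<longrightarrow> b (n + j) = 0) \<and>
          (\<forall>j\<ge>l. norm (b (n + j)) \<le> real j))"
      using l(2) lower_density_block_starts[of l]
      by (intro exI[of _ "{block_start k |k. block_level k = l}"] exI[of _ l] conjI ballI) simp_all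
  qed
qed

subsection \<open>Frequently hypercyclic functions of slow growth\<close>

text \<open>Since the weight of index \<open>n\<close> is at least \<open>n\<close>, the factor
  \<open>n / r\<close> turns the term of index \<open>n\<close> into at most the preceding one.
  Allowing \<open>1 + n / r\<close> thus only doubles the constant.\<close>

lemma dunkl_series_coefficient_bounds:
  assumes \<alpha>: "\<alpha> > - 1 / 2"
  obtains C where "C > 0"
    "\<And>r K (b :: nat \<Rightarrow> complex). r > 0 \<Longrightarrow> 0 \<le> K \<Longrightarrow> (\<And>n. norm (b n) \<le> K * (1 + real n / r)) \<Longrightarrow>
        summable (\<lambda>n. norm (b n / of_real (dunkl_fact \<alpha> n)) * r ^ n)"
    "\<And>r K (b :: nat \<Rightarrow> complex). r > 0 \<Longrightarrow> 0 \<le> K \<Longrightarrow> (\<And>n. norm (b n) \<le> K * (1 + real n / r)) \<Longrightarrow>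
        (\<Sum>n. norm (b n / of_real (dunkl_fact \<alpha> n)) * r ^ n) \<le> C * K * (exp r * r powr - (\<alpha> + 1 / 2))"
    "\<And>r K (b :: nat \<Rightarrow> complex). r > 0 \<Longrightarrow> 0 \<le> K \<Longrightarrow> (\<And>n. norm (b n) \<le> K * (1 + real n / r)) \<Longrightarrow>
        (\<Sum>n. (norm (b n / of_real (dunkl_fact \<alpha> n)) * r ^ n)\<^sup>2)
          \<le> (C * K * (exp r * r powr - (\<alpha> + 3 / 4)))\<^sup>2"
proof -
  obtain C where C: "C > 0"
    "\<And>r. r > 0 \<Longrightarrow> summable (\<lambda>n. r ^ n / dunkl_fact \<alpha> n)"
    "\<And>r. r > 0 \<Longrightarrow> (\<Sum>n. r ^ n / dunkl_fact \<alpha> n) \<le> C * (exp r * r powr - (\<alpha> + 1 / 2))"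
    "\<And>r. r > 0 \<Longrightarrow> summable (\<lambda>n. (r ^ n / dunkl_fact \<alpha> n)\<^sup>2)"
    "\<And>r. r > 0 \<Longrightarrow> (\<Sum>n. (r ^ n / dunkl_fact \<alpha> n)\<^sup>2) \<le> (C * (exp r * r powr - (\<alpha> + 3 / 4)))\<^sup>2"
    by (rule dunkl_series_growth[OF \<alpha>]) blast
  have main: "summable (\<lambda>n. norm (b n / of_real (dunkl_fact \<alpha> n)) * r ^ n)
    \<and> (\<Sum>n. norm (b n / of_real (dunkl_fact \<alpha> n)) * r ^ n) \<le> 2 * C * K * (exp r * r powr - (\<alpha> + 1 / 2))
    \<and> (\<Sum>n. (norm (b n / of_real (dunkl_fact \<alpha> n)) * r ^ n)\<^sup>2)
          \<le> (2 * C * K * (exp r * r powr - (\<alpha> + 3 / 4)))\<^sup>2"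
    if r: "r > 0" and K: "0 \<le> K" and b: "\<And>n. norm (b n) \<le> K * (1 + real n / r)"
    for r K and b :: "nat \<Rightarrow> complex"
  proof -
    define u where "u = (\<lambda>n. r ^ n / dunkl_fact \<alpha> n)"
    \<comment> \<open>The shift of \<open>u\<close> by one place, with 0 in front, so
      \<open>v\<close> has the same sum and the same sum of squares as \<open>u\<close>.\<close>
    define v where "v n = (case n of 0 \<Rightarrow> 0 | Suc m \<Rightarrow> u m)" for n
    define x where "x = (\<lambda>n. norm (b n / of_real (dunkl_fact \<alpha> n)) * r ^ n)"
    have u0: "0 \<le> u n" for n using r dunkl_fact_pos[OF \<alpha>, of n] by (simp add: u_def)
    then have v0: "0 \<le> v n" for n by (simp add: v_def split: nat.split)
    have su: "summable u" "summable (\<lambda>n. (u n)\<^sup>2)" using C(2,4)[OF r] by (simp_all add: u_def)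
    have v: "v sums suminf u" "(\<lambda>n. (v n)\<^sup>2) sums (\<Sum>n. (u n)\<^sup>2)"
      using sums_Suc[of v "suminf u"] sums_Suc[of "\<lambda>n. (v n)\<^sup>2" "\<Sum>n. (u n)\<^sup>2"] su
      by (simp_all add: v_def summable_sums)
    have nu: "real n / r * u n \<le> v n" for n
    proof (cases n)
      case (Suc m)
      have "real n \<le> dunkl_weight \<alpha> n" by (rule dunkl_weight_ge[OF \<alpha>])
      then have "real n * u m \<le> dunkl_weight \<alpha> n * u m" using u0 by (intro mult_right_mono)
      moreover have "0 < dunkl_weight \<alpha> n" using dunkl_weight_Suc_pos[OF \<alpha>] by (simp add: Suc)
      ultimately have "real n * u m / dunkl_weight \<alpha> n \<le> u m"
        by (simp add: pos_divide_le_eq mult.commute)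
      moreover have "real n / r * u n = real n * u m / dunkl_weight \<alpha> n"
        using r by (simp add: u_def Suc dunkl_fact_Suc)
      ultimately show ?thesis by (simp add: v_def Suc)
    qed (simp add: v_def)
    have x0: "0 \<le> x n" for n using r by (simp add: x_def)
    have xn: "x n \<le> K * (u n + v n)" for n
    proof -
      have "x n = norm (b n) * u n"
        using dunkl_fact_pos[OF \<alpha>, of n] by (simp add: x_def u_def norm_divide)
      also have "\<dots> \<le> K * (1 + real n / r) * u n" by (intro mult_right_mono b u0)
      also have "\<dots> = K * (u n + real n / r * u n)" by (simp add: algebra_simps)
      also have "\<dots> \<le> K * (u n + v n)" using nu K by (intro mult_left_mono add_left_mono)
      finally show ?thesis .
    qed
    have suv: "(\<lambda>n. K * (u n + v n)) sums (K * (suminf u + suminf u))"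
      by (intro sums_mult sums_add v su summable_sums)
    have sx: "summable x"
      by (rule summable_comparison_test'[OF sums_summable[OF suv], of 0]) (use xn x0 in auto)
    have "suminf x \<le> (\<Sum>n. K * (u n + v n))"
      by (rule suminf_le[OF xn sx sums_summable[OF suv]])
    also have "\<dots> = 2 * K * suminf u" using suv by (simp add: sums_iff)
    also have "\<dots> \<le> 2 * K * (C * (exp r * r powr - (\<alpha> + 1 / 2)))"
      unfolding u_def using C(3)[OF r] K by (intro mult_left_mono) auto
    finally have 1: "suminf x \<le> 2 * C * K * (exp r * r powr - (\<alpha> + 1 / 2))" by (simp add: mult_ac)
    have xn2: "(x n)\<^sup>2 \<le> 2 * K\<^sup>2 * ((u n)\<^sup>2 + (v n)\<^sup>2)" for n
    proof -
      have "(x n)\<^sup>2 \<le> (K * (u n + v n))\<^sup>2" using xn x0 by (intro power_mono)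
      also have "\<dots> = K\<^sup>2 * (u n + v n)\<^sup>2" by (rule power_mult_distrib)
      also have "\<dots> \<le> K\<^sup>2 * (2 * ((u n)\<^sup>2 + (v n)\<^sup>2))"
        using sum_squares_bound[of "u n" "v n"]
        by (intro mult_left_mono) (auto simp: power2_sum)
      finally show ?thesis by (simp add: algebra_simps)
    qed
    have suv2: "(\<lambda>n. 2 * K\<^sup>2 * ((u n)\<^sup>2 + (v n)\<^sup>2)) sums (2 * K\<^sup>2 * ((\<Sum>n. (u n)\<^sup>2) + (\<Sum>n. (u n)\<^sup>2)))"
      by (intro sums_mult sums_add v su summable_sums)
    have sx2: "summable (\<lambda>n. (x n)\<^sup>2)"
      by (rule summable_comparison_test'[OF sums_summable[OF suv2], of 0]) (use xn2 in auto)
    have "(\<Sum>n. (x n)\<^sup>2) \<le> (\<Sum>n. 2 * K\<^sup>2 * ((u n)\<^sup>2 + (v n)\<^sup>2))"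
      by (rule suminf_le[OF xn2 sx2 sums_summable[OF suv2]])
    also have "\<dots> = 4 * K\<^sup>2 * (\<Sum>n. (u n)\<^sup>2)" using suv2 by (simp add: sums_iff)
    also have "\<dots> \<le> 4 * K\<^sup>2 * (C * (exp r * r powr - (\<alpha> + 3 / 4)))\<^sup>2"
      unfolding u_def using C(5)[OF r] by (intro mult_left_mono) auto
    also have "\<dots> = (2 * C * K * (exp r * r powr - (\<alpha> + 3 / 4)))\<^sup>2"
      unfolding power_mult_distrib by simp
    finally show ?thesis using 1 sx unfolding x_def by blast
  qed
  show ?thesis
  proof (rule that[of "2 * C"])
    show "2 * C > 0" using C(1) by simp
    fix r K :: real and b :: "nat \<Rightarrow> complex"
    assume "r > 0" "0 \<le> K" "\<And>n. norm (b n) \<le> K * (1 + real n / r)"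
    note * = main[OF this]
    show "summable (\<lambda>n. norm (b n / of_real (dunkl_fact \<alpha> n)) * r ^ n)"
      "(\<Sum>n. norm (b n / of_real (dunkl_fact \<alpha> n)) * r ^ n)
        \<le> 2 * C * K * (exp r * r powr - (\<alpha> + 1 / 2))"
      "(\<Sum>n. (norm (b n / of_real (dunkl_fact \<alpha> n)) * r ^ n)\<^sup>2)
        \<le> (2 * C * K * (exp r * r powr - (\<alpha> + 3 / 4)))\<^sup>2"
      by (rule conjunct1[OF *], rule conjunct1[OF conjunct2[OF *]], rule conjunct2[OF conjunct2[OF *]])
  qed
qed

lemma power_series_entire:
  assumes "\<And>z. (\<lambda>n. a n * z ^ n) sums f z"
  shows "f \<in> entire"
proof -
  have "f = (\<lambda>z. \<Sum>n. a n * z ^ n)" using assms by (auto simp: sums_iff)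
  moreover have "((\<lambda>z. \<Sum>n. a n * z ^ n) has_field_derivative (\<Sum>n. diffs a n * z ^ n)) (at z)" for z
    by (rule termdiffs_strong_converges_everywhere) (use assms sums_summable in blast)
  ultimately show ?thesis
    unfolding entire_def by (auto simp: holomorphic_on_open)
qed

text \<open>The infimum below is the largest \<open>h\<close> satisfying the last property. Allowing the factor
  \<open>1 + n / r\<close> removes all regularity assumptions on \<open>\<psi>\<close>.\<close>

lemma slow_minorant:
  fixes \<psi> :: "real \<Rightarrow> real"
  assumes "filterlim \<psi> at_top at_top"
  obtains R h where "R \<ge> 1" "mono h" "filterlim h at_top sequentially" "\<And>n. 0 \<le> h n"
    "\<And>n r. r \<ge> R \<Longrightarrow> h n \<le> \<psi> r * (1 + real n / r)"
proof -
  have ev: "\<exists>Y. \<forall>y\<ge>Y. M \<le> \<psi> y" for M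
    using assms by (auto simp: filterlim_at_top eventually_at_top_linorder)
  obtain R' where R': "\<And>y. y \<ge> R' \<Longrightarrow> 1 \<le> \<psi> y" using ev by blast
  define R where "R = max 1 R'"
  have R: "R \<ge> 1" "\<And>y. y \<ge> R \<Longrightarrow> 1 \<le> \<psi> y" using R' by (auto simp: R_def)
  define g where "g n r = \<psi> r * (1 + real n / r)" for n r
  define h where "h n = (INF r\<in>{R..}. g n r)" for n
  have g0: "0 \<le> g n r" if "r \<ge> R" for n r
    using R(1) R(2)[OF that] that by (simp add: g_def)
  have bdd: "bdd_below (g n ` {R..})" for n using g0 by (intro bdd_belowI[of _ 0]) auto
  have h_le: "h n \<le> g n r" if "r \<ge> R" for n r
    unfolding h_def using that by (intro cINF_lower bdd) auto
  show ?thesis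
  proof (rule that[of R h])
    show "R \<ge> 1" by fact
    show "mono h"
    proof (rule monoI)
      fix m n :: nat assume "m \<le> n"
      have "g m r \<le> g n r" if "r \<ge> R" for r
        unfolding g_def using R(1) R(2)[OF that] that \<open>m \<le> n\<close>
        by (intro mult_left_mono add_left_mono divide_right_mono) auto
      then show "h m \<le> h n"
        unfolding h_def by (intro cINF_mono bdd) auto
    qed
    show "0 \<le> h n" for n
      unfolding h_def using g0 by (intro cINF_greatest) auto
    show "h n \<le> \<psi> r * (1 + real n / r)" if "r \<ge> R" for n r
      using h_le[OF that] by (simp add: g_def)
    show "filterlim h at_top sequentially"
      unfolding filterlim_at_top
    proof
      fix M :: real
      obtain Y where Y: "\<And>y. y \<ge> Y \<Longrightarrow> M \<le> \<psi> y" using ev by blast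
      \<comment> \<open>For \<open>r \<ge> Y\<close> the function \<open>\<psi>\<close> is already
        large; for \<open>r < Y\<close> this size of \<open>n\<close> makes \<open>n / r\<close> at
        least \<open>\<bar>M\<bar>\<close>.\<close>
      have "\<forall>\<^sub>F n in sequentially. \<bar>M\<bar> * \<bar>Y\<bar> \<le> real n"
        using filterlim_real_sequentially by (simp add: filterlim_at_top)
      then show "\<forall>\<^sub>F n in sequentially. M \<le> h n"
      proof eventually_elim
        case (elim n)
        have "M \<le> g n r" if r: "r \<ge> R" for r
        proof (cases "r \<ge> Y")
          case True
          have "M * 1 \<le> \<psi> r * (1 + real n / r)"
            using Y[OF True] R(1) R(2)[OF r] r by (intro mult_mono) auto
          then show ?thesis by (simp add: g_def)
        next
          case False
          have "\<bar>M\<bar> * r \<le> \<bar>M\<bar> * \<bar>Y\<bar>" using False by (intro mult_left_mono) auto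
          then have "\<bar>M\<bar> \<le> real n / r"
            using elim R(1) r by (simp add: pos_le_divide_eq)
          then have "M \<le> real n / r" by (rule order_trans[OF abs_ge_self])
          then have "M \<le> 1 * (1 + real n / r)" by (simp add: add_increasing)
          also have "\<dots> \<le> \<psi> r * (1 + real n / r)"
            using R(1) R(2)[OF r] r by (intro mult_right_mono) auto
          finally show ?thesis by (simp add: g_def)
        qed
        then show "M \<le> h n" unfolding h_def by (intro cINF_greatest) auto
      qed
    qed
  qed
qed

lemma sums_tail:
  fixes x :: "nat \<Rightarrow> real"
  assumes "summable x"
  shows "(\<lambda>n. if n < N then 0 else x n) sums (\<Sum>n. x (n + N))"
proof -
  have "(\<lambda>n. x (n + N)) sums (\<Sum>n. x (n + N))"
    using assms by (intro summable_sums summable_ignore_initial_segment)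
  then show ?thesis
    using sums_iff_shift[of "\<lambda>n. if n < N then 0 else x n" N "\<Sum>n. x (n + N)"] by simp
qed

theorem theorem5:
  fixes \<alpha> a :: real and p :: ereal and \<phi> :: "real \<Rightarrow> real"
  assumes "\<alpha> > - 1 / 2"
    and "1 \<le> p"
    and "a = \<alpha> + 1 / 2 + real_of_ereal (1 / (2 * max 2 p))"
    and "\<And>r. r > 0 \<Longrightarrow> \<phi> r > 0"
    and "filterlim \<phi> at_top at_top"
  shows "\<exists>f \<in> entire.
           (\<forall>\<^sub>F r in at_top. integral_mean p f r \<le> \<phi> r * (exp r / r powr a)) \<and>
           frequently_hypercyclic entire_topology (dunkl \<alpha>) f"
proof -
  note \<alpha> = assms(1)
  define w where "w = real_of_ereal (1 / (2 * max 2 p))"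
  let ?\<gamma> = "dunkl_fact \<alpha>"
  note \<gamma>_pos = dunkl_fact_pos[OF \<alpha>]
  obtain C where C: "C > 0"
    "\<And>r K (b :: nat \<Rightarrow> complex). r > 0 \<Longrightarrow> 0 \<le> K \<Longrightarrow> (\<And>n. norm (b n) \<le> K * (1 + real n / r)) \<Longrightarrow>
        summable (\<lambda>n. norm (b n / of_real (?\<gamma> n)) * r ^ n)"
    "\<And>r K (b :: nat \<Rightarrow> complex). r > 0 \<Longrightarrow> 0 \<le> K \<Longrightarrow> (\<And>n. norm (b n) \<le> K * (1 + real n / r)) \<Longrightarrow>
        (\<Sum>n. norm (b n / of_real (?\<gamma> n)) * r ^ n) \<le> C * K * (exp r * r powr - (\<alpha> + 1 / 2))"
    "\<And>r K (b :: nat \<Rightarrow> complex). r > 0 \<Longrightarrow> 0 \<le> K \<Longrightarrow> (\<And>n. norm (b n) \<le> K * (1 + real n / r)) \<Longrightarrow>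
        (\<Sum>n. (norm (b n / of_real (?\<gamma> n)) * r ^ n)\<^sup>2)
          \<le> (C * K * (exp r * r powr - (\<alpha> + 3 / 4)))\<^sup>2"
    by (rule dunkl_series_coefficient_bounds[OF \<alpha>]) blast
  \<comment> \<open>Cancels the constant \<open>C\<close> of the coefficient bounds and the factor 2
    of \<open>integral_mean_le\<close>.\<close>
  define \<psi> where "\<psi> r = 1 / (2 * C) * \<phi> r" for r
  have "filterlim \<psi> at_top at_top"
    unfolding \<psi>_def using C(1)
    by (intro filterlim_tendsto_pos_mult_at_top[OF tendsto_const _ assms(5)]) auto
  then obtain R h where R: "R \<ge> 1" and h: "mono h" "filterlim h at_top sequentially" "\<And>n. 0 \<le> h n"
    and h_le: "\<And>n r. r \<ge> R \<Longrightarrow> h n \<le> \<psi> r * (1 + real n / r)"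
    by (rule slow_minorant) blast
  obtain b :: "nat \<Rightarrow> complex" where b_le: "\<And>n. norm (b n) \<le> h n"
    and b: "\<And>c N L \<epsilon>. \<epsilon> > 0 \<Longrightarrow> \<exists>A l. L \<le> l \<and> lower_density A > 0 \<and>
        (\<forall>n\<in>A. (\<forall>j<N. norm (b (n + j) - c j) < \<epsilon>) \<and> (\<forall>j\<ge>N. j < l \<longrightarrow> b (n + j) = 0) \<and>
          (\<forall>j\<ge>l. norm (b (n + j)) \<le> real j))"
    by (rule universal_sequence[OF h]) blast
  have b_bound: "norm (b n) \<le> \<psi> r * (1 + real n / r)" if "r \<ge> R" for n r
    using b_le[of n] h_le[OF that, of n] by linarith
  have \<psi>0: "0 < \<psi> r" if "r \<ge> R" for r
    using assms(4)[of r] C(1) R that by (simp add: \<psi>_def)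
  define d where "d n = b n / of_real (?\<gamma> n)" for n
  have sd: "summable (\<lambda>n. norm (d n) * r ^ n)" if "r \<ge> R" for r
    unfolding d_def using that R \<psi>0[OF that] by (intro C(2)[of r "\<psi> r"] b_bound) auto
  define f where "f z = (\<Sum>n. d n * z ^ n)" for z
  have f: "(\<lambda>n. d n * z ^ n) sums f z" for z
  proof -
    \<comment> \<open>Coefficient bounds are available only for radii at least \<open>R\<close>;
      smaller discs are covered by comparison.\<close>
    define r where "r = max R (norm z)"
    have "summable (\<lambda>n. d n * z ^ n)"
      by (rule summable_comparison_test'[OF sd[of r], of 0])
        (auto simp: r_def norm_mult norm_power intro!: mult_left_mono power_mono)
    then show ?thesis unfolding f_def by (rule summable_sums)
  qed
  have iter: "(\<lambda>n. b (n + m) / of_real (?\<gamma> n) * z ^ n) sums (dunkl \<alpha> ^^ m) f z" for m z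
    by (rule dunkl_funpow_power_series[OF \<alpha>]) (use f in \<open>simp add: d_def\<close>)
  have fE: "f \<in> entire" using f by (rule power_series_entire)
  have growth: "integral_mean p f r \<le> \<phi> r * (exp r / r powr a)" if r: "r \<ge> R" for r
  proof -
    have r0: "r > 0" using r R by simp
    \<comment> \<open>\<open>A\<close> bounds the sup norm and \<open>A * q\<close> the quadratic
      mean; \<open>q\<close> is the gain between the exponents \<open>\<alpha> + 1 / 2\<close> and
      \<open>\<alpha> + 3 / 4\<close>.\<close>
    define A where "A = C * \<psi> r * (exp r * r powr - (\<alpha> + 1 / 2))"
    define q where "q = r powr - (1 / 4)"
    have "integral_mean p f r \<le> 2 * A * q powr (4 * w)"
      unfolding w_def
    proof (rule integral_mean_le)
      show "1 \<le> p" by fact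
      show "0 \<le> r" "0 < A" "0 < q"
        using r0 C(1) \<psi>0[OF r] by (simp_all add: A_def q_def)
      show "continuous_on (sphere 0 r) f"
        using fE by (auto simp: entire_def intro: holomorphic_on_imp_continuous_on holomorphic_on_subset)
      show "norm (f z) \<le> A" if z: "norm z = r" for z
      proof -
        have nz: "norm (d n * z ^ n) = norm (d n) * r ^ n" for n
          by (simp add: norm_mult norm_power z)
        have "norm (\<Sum>n. d n * z ^ n) \<le> (\<Sum>n. norm (d n * z ^ n))"
          by (rule summable_norm) (use sd[OF r] in \<open>simp add: nz\<close>)
        also have "\<dots> \<le> A"
          unfolding nz unfolding A_def d_def using r0 \<psi>0[OF r] by (intro C(3) b_bound r) auto
        finally show ?thesis by (simp add: f_def)
      qed
      have "integral {0..2 * pi} (\<lambda>t. (norm (f (of_real r * exp (\<i> * of_real t))))\<^sup>2)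
          = 2 * pi * (\<Sum>n. (norm (d n) * r ^ n)\<^sup>2)"
        using r0 by (intro integral_unique has_integral_norm_sq_circle sd r f) auto
      also have "(\<Sum>n. (norm (d n) * r ^ n)\<^sup>2) \<le> (C * \<psi> r * (exp r * r powr - (\<alpha> + 3 / 4)))\<^sup>2"
        unfolding d_def using r0 \<psi>0[OF r] by (intro C(4) b_bound r) auto
      also have "r powr - (\<alpha> + 3 / 4) = r powr - (\<alpha> + 1 / 2) * q"
      proof -
        have "- (\<alpha> + 3 / 4) = - (\<alpha> + 1 / 2) + - (1 / 4)" by simp
        then show ?thesis unfolding q_def by (simp only: powr_add)
      qed
      also have "C * \<psi> r * (exp r * (r powr - (\<alpha> + 1 / 2) * q)) = A * q" by (simp add: A_def)
      finally show "integral {0..2 * pi} (\<lambda>t. (norm (f (of_real r * exp (\<i> * of_real t))))\<^sup>2)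
          \<le> 2 * pi * (A * q)\<^sup>2"
        by simp
    qed
    also have "q powr (4 * w) = r powr - w" by (simp add: q_def powr_powr)
    also have "2 * A * r powr - w = \<phi> r * (exp r * (r powr - (\<alpha> + 1 / 2) * r powr - w))"
      using C(1) by (simp add: A_def \<psi>_def)
    also have "r powr - (\<alpha> + 1 / 2) * r powr - w = r powr - a"
    proof -
      have "- (\<alpha> + 1 / 2) + - w = - a" by (simp add: assms(3) w_def)
      then show ?thesis by (simp only: powr_add[symmetric])
    qed
    finally show ?thesis by (simp add: powr_minus_divide)
  qed
  have "lower_density {n. (dunkl \<alpha> ^^ n) f \<in> U} > 0"
    if U: "openin entire_topology U" "U \<noteq> {}" for U
  proof -
    obtain g where g: "g \<in> U" using U(2) by blast
    then have gE: "g \<in> entire" using U(1) openin_entire_topology by blast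
    obtain K \<epsilon> where K: "compact K" "\<epsilon> > 0"
      "{k \<in> entire. \<forall>z\<in>K. norm (k z - g z) < \<epsilon>} \<subseteq> U"
      using U(1) g unfolding openin_entire_topology by blast
    obtain B where B: "\<And>z. z \<in> K \<Longrightarrow> norm z \<le> B"
      using compact_imp_bounded[OF K(1)] by (auto simp: bounded_iff)
    \<comment> \<open>The maximum with 1 keeps the radius positive even when \<open>K\<close> is
      empty or \<open>{0}\<close>.\<close>
    define \<rho> where "\<rho> = max 1 B"
    have \<rho>: "\<rho> > 0" "\<And>z. z \<in> K \<Longrightarrow> norm z \<le> \<rho>" using B by (auto simp: \<rho>_def intro: max.coboundedI2)
    define t where "t n = (deriv ^^ n) g 0 / fact n" for n
    have t: "(\<lambda>n. t n * z ^ n) sums g z" for z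
      using holomorphic_power_series[of g 0 "norm z + 1" z] gE
      by (auto simp: t_def entire_def intro: holomorphic_on_subset)
    \<comment> \<open>The target \<open>g\<close> in the scaling in which the operator is a plain
      shift.\<close>
    define c where "c n = t n * of_real (?\<gamma> n)" for n
    define u where "u = (\<lambda>n. \<rho> ^ n / ?\<gamma> n)"
    have u0: "0 \<le> u n" for n using \<rho>(1) \<gamma>_pos[of n] by (simp add: u_def)
    have su: "summable u"
      using C(2)[of \<rho> 1 "\<lambda>_. 1"] \<rho>(1) \<gamma>_pos by (simp add: u_def norm_divide less_imp_le)
    \<comment> \<open>An instance of the coefficient bound, as
      \<open>n \<le> \<rho> * (1 + n / \<rho>)\<close>.\<close>
    have snu: "summable (\<lambda>n. real n * u n)"
      using C(2)[of \<rho> \<rho> "of_nat"] \<rho>(1) \<gamma>_pos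
      by (simp add: u_def norm_divide distrib_left less_imp_le)
    have st: "summable (\<lambda>n. norm (t n) * \<rho> ^ n)"
      using powser_insidea[of t "of_real (\<rho> + 1)" "of_real \<rho>"] t sums_summable \<rho>(1)
      by (simp add: norm_mult norm_power del: of_real_add) blast
    \<comment> \<open>Three errors of at most \<open>\<epsilon> / 4\<close> each: the Taylor tail of
      \<open>g\<close> from \<open>N\<close>, the linearly bounded coefficients from
      \<open>L\<close>, and the deviation \<open>\<eta>\<close> in the first \<open>N\<close>
      coefficients.\<close>
    obtain N where N: "norm (\<Sum>n. norm (t (n + N)) * \<rho> ^ (n + N)) < \<epsilon> / 4"
      using suminf_exist_split[of "\<epsilon> / 4", OF _ st] K(2) by auto
    obtain L where L: "norm (\<Sum>n. real (n + L) * u (n + L)) < \<epsilon> / 4"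
      using suminf_exist_split[of "\<epsilon> / 4", OF _ snu] K(2) by auto
    define \<eta> where "\<eta> = \<epsilon> / (4 * (1 + suminf u))"
    have s0: "0 \<le> suminf u" by (rule suminf_nonneg[OF su u0])
    have \<eta>: "\<eta> > 0" using K(2) s0 by (simp add: \<eta>_def add_pos_nonneg)
    have \<eta>u: "\<eta> * suminf u \<le> \<epsilon> / 4"
      using K(2) s0 by (simp add: \<eta>_def field_simps add_pos_nonneg)
    obtain A l where A: "L \<le> l" "lower_density A > 0" and
      "\<forall>n\<in>A. (\<forall>j<N. norm (b (n + j) - c j) < \<eta>) \<and> (\<forall>j\<ge>N. j < l \<longrightarrow> b (n + j) = 0) \<and>
          (\<forall>j\<ge>l. norm (b (n + j)) \<le> real j)"
      using b[OF \<eta>, of L N c] by (elim exE conjE)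
    then have An:
      "\<And>n j. n \<in> A \<Longrightarrow> j < N \<Longrightarrow> norm (b (n + j) - c j) < \<eta>"
      "\<And>n j. n \<in> A \<Longrightarrow> N \<le> j \<Longrightarrow> j < l \<Longrightarrow> b (n + j) = 0"
      "\<And>n j. n \<in> A \<Longrightarrow> l \<le> j \<Longrightarrow> norm (b (n + j)) \<le> real j"
      by blast+
    have "(dunkl \<alpha> ^^ n) f \<in> U" if n: "n \<in> A" for n
    proof -
      define k where "k = (dunkl \<alpha> ^^ n) f"
      \<comment> \<open>A majorant independent of \<open>z\<close> and \<open>n\<close>. Between
        \<open>N\<close> and \<open>l\<close> the shifted sequence vanishes, and since
        \<open>L \<le> l\<close> its later part is covered by the tail from \<open>L\<close>, which
        was fixed before \<open>l\<close>.\<close>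
      define m where "m j = \<eta> * u j + (if j < N then 0 else norm (t j) * \<rho> ^ j)
          + (if j < L then 0 else real j * u j)" for j
      define S where "S = \<eta> * suminf u + (\<Sum>j. norm (t (j + N)) * \<rho> ^ (j + N))
          + (\<Sum>j. real (j + L) * u (j + L))"
      have m: "m sums S"
        unfolding m_def S_def
        by (intro sums_add sums_mult summable_sums[OF su] sums_tail[OF st] sums_tail[OF snu])
      have S: "S < \<epsilon>" using N L \<eta>u K(2) unfolding S_def by simp
      have "norm (k z - g z) < \<epsilon>" if z: "z \<in> K" for z
      proof -
        define y where "y j = b (j + n) / of_real (?\<gamma> j) * z ^ j - t j * z ^ j" for j
        have y: "y sums (k z - g z)"
          unfolding y_def k_def by (intro sums_diff iter t)
        have zp: "norm z ^ j \<le> \<rho> ^ j" for j using \<rho>(2)[OF z] by (intro power_mono) auto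
        have bu: "norm (x / of_real (?\<gamma> j) * z ^ j) \<le> e * u j" if "norm x \<le> e" for x :: complex and e j
        proof -
          have "0 \<le> e" using norm_ge_zero that by (rule order_trans)
          then have "norm x / ?\<gamma> j * norm z ^ j \<le> e / ?\<gamma> j * \<rho> ^ j"
            using that zp[of j] \<gamma>_pos[of j] by (intro mult_mono divide_right_mono) auto
          then show ?thesis
            using \<gamma>_pos[of j] by (simp add: u_def norm_mult norm_divide norm_power)
        qed
        have ym: "norm (y j) \<le> m j" for j
        proof (cases "j < N")
          case True
          have "y j = (b (n + j) - c j) / of_real (?\<gamma> j) * z ^ j"
            using \<gamma>_pos[of j] by (simp add: y_def c_def field_simps add.commute)
          then have "norm (y j) \<le> \<eta> * u j"
            using bu[OF less_imp_le[OF An(1)[OF n True]]] by simp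
          then show ?thesis using True u0[of j] by (simp add: m_def add_increasing2)
        next
          case False
          have "norm (b (j + n) / of_real (?\<gamma> j) * z ^ j) \<le> (if j < L then 0 else real j * u j)"
          proof (cases "j < l")
            case True
            then have "b (j + n) = 0" using An(2)[OF n, of j] False by (simp add: add.commute)
            then show ?thesis using u0[of j] by simp
          next
            case False
            then show ?thesis using bu[OF An(3)[OF n, of j]] A(1) by (simp add: add.commute)
          qed
          moreover have "norm (t j * z ^ j) \<le> norm (t j) * \<rho> ^ j"
            using zp[of j] by (simp add: norm_mult norm_power mult_left_mono)
          moreover have "norm (y j) \<le> norm (b (j + n) / of_real (?\<gamma> j) * z ^ j) + norm (t j * z ^ j)"
            unfolding y_def by (rule norm_triangle_ineq4)
          moreover have "0 \<le> \<eta> * u j" using \<eta> u0[of j] by simp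
          ultimately show ?thesis using False unfolding m_def by simp
        qed
        have "norm (k z - g z) = norm (suminf y)" using y by (simp add: sums_iff)
        also have "\<dots> \<le> suminf m"
          by (rule norm_suminf_le[OF ym sums_summable[OF m]])
        also have "\<dots> = S" using m by (simp add: sums_iff)
        finally show ?thesis using S by simp
      qed
      moreover have "k \<in> entire" using iter[where m = n] unfolding k_def by (rule power_series_entire)
      ultimately show ?thesis using K(3) unfolding k_def by blast
    qed
    then have "lower_density A \<le> lower_density {n. (dunkl \<alpha> ^^ n) f \<in> U}"
      by (intro lower_density_mono) blast
    with A(2) show ?thesis by (rule less_le_trans)
  qed
  then have "frequently_hypercyclic entire_topology (dunkl \<alpha>) f"
    using fE by (simp add: frequently_hypercyclic_def)
  moreover have "\<forall>\<^sub>F r in at_top. integral_mean p f r \<le> \<phi> r * (exp r / r powr a)"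
    using eventually_ge_at_top[of R] by eventually_elim (rule growth)
  ultimately show ?thesis using fE by blast
qed

end
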